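(* Let $\theta^{(1)},\ldots,\theta^{(n)}\in\partial_e\mathcal M_T(X)$ be a finite collection of ergodic measures on $X$, and let $\mathcal C$ be a compact subset of the convex hull of $\{\theta^{(1)},\ldots,\theta^{(n)}\}$. Suppose $\mathbf F=(F_k)_{k=1}^\infty$ is a tempered Følner sequence, and that $\mu$ is a Borel probability measure on $X$ that neglects shells. Then there exist points $x^{(1)},\ldots,x^{(n)}$ and sequences of radii $(r_k^{(1)})_{k=1}^\infty,\ldots,(r_k^{(n)})_{k=1}^\infty$ such that $$\operatorname{LS}\left(\left(\alpha_{B\left(x^{(1)},\ldots,x^{(n)};r_k^{(1)},\ldots,r_k^{(n)}\right)}\circ\operatorname{Avg}_{F_k}\right)_{k=1}^\infty\right)=\mathcal C.$$ Moreover, the set of $n$-tuples $(x^{(1)},\ldots,x^{(n)})\in X^n$ which admit such sequences $(r_k^{(1)},\ldots,r_k^{(n)})_{k=1}^\infty$ is of full probability with respect to the product measure $\theta^{(1)}\times\cdots\times\theta^{(n)}$.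
   Context: $(X,\rho)$ is a compact metric space, $G$ is a discrete amenable group, and $T:G\curvearrowright X$ is a left action by homeomorphisms $(T_g)_{g\in G}$ ($T_{g_1}\circ T_{g_2}=T_{g_1g_2}$, $T_{1_G}=\mathrm{id}_X$) that are Hölder: there are functions $H,L:G\to(0,\infty)$ with $\rho(T_gx,T_gy)\le L(g)\cdot\rho(x,y)^{H(g)}$ for all $g\in G$, $x,y\in X$. A sequence $(F_k)_{k=1}^\infty$ of nonempty finite subsets of $G$ is Følner if $\lim_{k\to\infty}|F_k\Delta gF_k|/|F_k|=0$ for all $g\in G$; it is tempered if there is $c>0$ with $\left|\bigcup_{j=1}^{k-1}F_j^{-1}F_k\right|\le c|F_k|$ for all $k\ge2$. $\mathcal M(X)$ is the space of Borel probability measures on $X$ with the weak* topology, $\mathcal M_T(X)$ the subspace of $T$-invariant ones, $\partial_e\mathcal M_T(X)$ its extreme points (the ergodic measures). Radii are positive real numbers. $B(x;r)=\{y\in X:\rho(x,y)<r\}$ and $B(x^{(1)},\ldots,x^{(n)};r^{(1)},\ldots,r^{(n)})=\bigcup_{h=1}^nB(x^{(h)};r^{(h)})$. For measurable $E\subseteq X$ with $\mu(E)>0$, $\alpha_E$ is the Borel probability measure $A\mapsto\mu(A\cap E)/\mu(E)$. For $\beta\in\mathcal M(X)$ and finite nonempty $F\subseteq G$, $\beta\circ\operatorname{Avg}_F\in\mathcal M(X)$ is defined by $(\beta\circ\operatorname{Avg}_F)(A)=\frac1{|F|}\sum_{g\in F}\beta(T_g^{-1}A)$. $\mu$ neglects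 shells if $\mu(\{y\in X:\rho(x,y)=r\})=0$ for all $x\in X$, $r\in[0,\infty)$. For a sequence $(z_k)_{k=1}^\infty$ in a topological space, $\operatorname{LS}((z_k)_{k=1}^\infty)$ is the set of all limits of convergent subsequences; here it is taken in $\mathcal M(X)$.
   Formalization: The formal theorem also assumes that C is nonempty and that, for each i, every ball around θ^(i)-almost every point has positive μ-measure; the claim fails without these (e.g. X={0}∪[1,2], trivial action, θ=δ_0, μ Lebesgue on [1,2], C={δ_0}). *)

theory Defs
  imports "HOL-Probability.Probability" "HOL-Algebra.Coset" "HOL-Algebra.Group_Action"
begin

definition amenable :: "('g, 'b) monoid_scheme \<Rightarrow> bool" where
  "amenable G \<longleftrightarrow> (\<exists>m :: 'g set \<Rightarrow> real.
     (\<forall>A. A \<subseteq> carrier G \<longrightarrow> 0 \<le> m A) \<and> m (carrier G) = 1 \<and>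
     (\<forall>A B. A \<subseteq> carrier G \<longrightarrow> B \<subseteq> carrier G \<longrightarrow> A \<inter> B = {} \<longrightarrow> m (A \<union> B) = m A + m B) \<and>
     (\<forall>g\<in>carrier G. \<forall>A. A \<subseteq> carrier G \<longrightarrow> m (g <#\<^bsub>G\<^esub> A) = m A))"

text \<open>Sequences are indexed from 0 throughout, so \<open>F k\<close> is the usual \<open>F\<^sub>k\<^sub>+\<^sub>1\<close>.\<close>

definition folner_seq :: "('g, 'b) monoid_scheme \<Rightarrow> (nat \<Rightarrow> 'g set) \<Rightarrow> bool" where
  "folner_seq G F \<longleftrightarrow>
     (\<forall>k. finite (F k) \<and> F k \<noteq> {} \<and> F k \<subseteq> carrier G) \<and>
     (\<forall>g\<in>carrier G.
        (\<lambda>k. real (card (sym_diff (F k) (g <#\<^bsub>G\<^esub> F k))) / real (card (F k))) \<longlonglongrightarrow> 0)"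

definition tempered :: "('g, 'b) monoid_scheme \<Rightarrow> (nat \<Rightarrow> 'g set) \<Rightarrow> bool" where
  "tempered G F \<longleftrightarrow> (\<exists>c>0. \<forall>k\<ge>1.
     real (card (\<Union>j<k. set_inv\<^bsub>G\<^esub> (F j) <#>\<^bsub>G\<^esub> F k)) \<le> c * real (card (F k)))"

definition holder_action ::
  "('g, 'b) monoid_scheme \<Rightarrow> ('g \<Rightarrow> 'a::metric_space \<Rightarrow> 'a) \<Rightarrow> bool" where
  "holder_action G T \<longleftrightarrow>
     group_action G UNIV T \<and>
     (\<forall>g\<in>carrier G. homeomorphism UNIV UNIV (T g) (T (inv\<^bsub>G\<^esub> g))) \<and>
     (\<exists>H L :: 'g \<Rightarrow> real. \<forall>g\<in>carrier G. 0 < H g \<and> 0 < L g \<and>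
        (\<forall>x y. dist (T g x) (T g y) \<le> L g * dist x y powr H g))"

definition borel_probs :: "'a::topological_space measure set" where
  "borel_probs = {M. prob_space M \<and> sets M = sets borel}"

text \<open>The coarsest topology on Borel probability measures that makes \<open>M \<mapsto> \<integral> f dM\<close>
  continuous for every continuous real \<open>f\<close>. It is meant for compact spaces, where all such \<open>f\<close>
  are bounded.\<close>

definition weak_star :: "'a::topological_space measure topology" where
  "weak_star = pullback_topology borel_probs
     (\<lambda>M. \<lambda>f\<in>{f :: 'a \<Rightarrow> real. continuous_on UNIV f}. \<integral>x. f x \<partial>M)
     (product_topology (\<lambda>_. euclideanreal) {f :: 'a \<Rightarrow> real. continuous_on UNIV f})"

definition invariant_measures ::
  "('g, 'b) monoid_scheme \<Rightarrow> ('g \<Rightarrow> 'a::topological_space \<Rightarrow> 'a) \<Rightarrow> 'a measure set" where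
  "invariant_measures G T =
     {M \<in> borel_probs. \<forall>g\<in>carrier G. \<forall>A\<in>sets borel. emeasure M (T g -` A) = emeasure M A}"

text \<open>The type of measures is not a real vector space, so the library's \<^const>\<open>extreme_point_of\<close> and
  \<^const>\<open>hull\<close> do not apply. The next two definitions say the same with setwise convex
  combinations.\<close>

definition extreme_measures :: "'a::topological_space measure set \<Rightarrow> 'a measure set" where
  "extreme_measures S = {M \<in> S. \<not> (\<exists>N1\<in>S. \<exists>N2\<in>S. N1 \<noteq> N2 \<and>
     (\<exists>t. 0 < t \<and> t < 1 \<and>
        (\<forall>A\<in>sets borel. measure M A = (1 - t) * measure N1 A + t * measure N2 A)))}"

definition measure_hull :: "'a::topological_space measure set \<Rightarrow> 'a measure set" where
  "measure_hull S = {M \<in> borel_probs. \<exists>I w. finite I \<and> I \<subseteq> S \<and>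
     (\<forall>N\<in>I. 0 \<le> w N) \<and> sum w I = (1 :: real) \<and>
     (\<forall>A\<in>sets borel. measure M A = (\<Sum>N\<in>I. w N * measure N A))}"

text \<open>The measure \<open>\<beta> \<circ> Avg\<^sub>F\<close>. The measure \<open>\<alpha>\<^sub>E\<close> is \<^term>\<open>uniform_measure \<mu> E\<close>.\<close>

definition avg_measure ::
  "('g \<Rightarrow> 'a::topological_space \<Rightarrow> 'a) \<Rightarrow> 'g set \<Rightarrow> 'a measure \<Rightarrow> 'a measure" where
  "avg_measure T F \<beta> = measure_of UNIV (sets borel)
     (\<lambda>A. (\<Sum>g\<in>F. emeasure \<beta> (T g -` A)) / of_nat (card F))"

definition neglects_shells :: "'a::metric_space measure \<Rightarrow> bool" where
  "neglects_shells \<mu> \<longleftrightarrow> (\<forall>x. \<forall>r\<ge>0. emeasure \<mu> {y. dist x y = r} = 0)"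

definition union_ball :: "'i set \<Rightarrow> ('i \<Rightarrow> 'a::metric_space) \<Rightarrow> ('i \<Rightarrow> real) \<Rightarrow> 'a set" where
  "union_ball I x r = (\<Union>i\<in>I. ball (x i) (r i))"

definition LS :: "'b topology \<Rightarrow> (nat \<Rightarrow> 'b) \<Rightarrow> 'b set" where
  "LS X z = {l. \<exists>s. strict_mono s \<and> limitin X (z \<circ> s) l sequentially}"

text \<open>Tuples are functions on the index set \<open>I\<close>; their values elsewhere are irrelevant. The measure
  \<open>\<alpha>\<close> of a set is only defined when the set has positive \<open>\<mu>\<close>-measure, so this is
  required of all the unions of balls.\<close>

definition admissible_radii ::
  "'a::metric_space measure \<Rightarrow> 'i set \<Rightarrow> ('i \<Rightarrow> 'a) \<Rightarrow> ('i \<Rightarrow> nat \<Rightarrow> real) \<Rightarrow> bool" where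
  "admissible_radii \<mu> I x r \<longleftrightarrow>
     (\<forall>i\<in>I. \<forall>k. 0 < r i k) \<and> (\<forall>k. 0 < emeasure \<mu> (union_ball I x (\<lambda>i. r i k)))"

end

(* A tuple of points x i that are generic for theta i works for every choice of weights. Let w k be a
   sequence of weight vectors that visits each element of a countable dense subset of the weights
   occurring in C infinitely often, and choose the k-th radii so small that every T g with g in F k
   moves the points of each ball close to the image of its centre, with the mu-measures of the balls
   proportional (up to 1/k) to the weights; the latter is possible because mu neglects shells. The
   k-th measure is then asymptotically the convex combination of the theta i with weights w k.
   Almost every point is generic by Lindenstrauss' pointwise ergodic theorem. Its maximal inequality
   is transferred from the group, where it follows from a greedy covering by translates of the sets
   F k with fractional masses; extremality enters through the mean ergodic theorem. *)

theory Submission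
  imports Defs "HOL-Real_Asymp.Real_Asymp"
begin

section \<open>Weak* convergence\<close>

text \<open>An average at \<open>T g x\<close> is a sum over the right translate
  \<open>F k #> g\<close>, so the covering works with right translates. The Folner condition
  concerns left translates: it removes the boundary terms of the transfer and makes the averages of
  \<open>f\<close> and of its translates asymptotically equal. Large scales are selected first
  because a centre of smaller scale j whose translate meets \<open>F k #> g'\<close> lies in
  \<open>(set_inv (F j) <#> F k) #> g'\<close>, and temperedness leaves at most
  \<open>c * card (F k)\<close> such centres. Continuous functions are scaled into [1/4, 3/4] so
  that the limit w of a norm-minimising sequence of convex combinations of translates and its
  complement 1 - w both normalise to densities of invariant measures; extremality then forces w to
  be constant. Weights may vanish although every radius is positive, and points of a tuple may
  coincide although the balls should be disjoint. Hence a small uniform weight is mixed in, and the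
  weights of equal points are added.\<close>

lemma borel_probsD:
  assumes "M \<in> borel_probs"
  shows "prob_space M" "sets M = sets borel" "space M = UNIV"
  using assms sets_eq_imp_space_eq[of M borel] by (auto simp: borel_probs_def)

lemma continuous_on_UNIV_abs_bounded:
  fixes f :: "'a::topological_space \<Rightarrow> real"
  assumes "compact (UNIV :: 'a set)" "continuous_on UNIV f"
  obtains B where "B > 0" "\<And>x. \<bar>f x\<bar> \<le> B"
proof -
  have "bounded (range f)"
    using assms compact_continuous_image compact_imp_bounded by blast
  then show ?thesis
    using that unfolding bounded_pos by auto
qed

lemma integrable_continuous:
  fixes f :: "'a::topological_space \<Rightarrow> real"
  assumes "compact (UNIV :: 'a set)" "continuous_on UNIV f" "finite_measure M" "sets M = sets borel"
  shows "integrable M f"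
proof -
  interpret finite_measure M by fact
  obtain B where "\<And>x. \<bar>f x\<bar> \<le> B"
    using continuous_on_UNIV_abs_bounded assms by blast
  moreover have "f \<in> borel_measurable M"
    using borel_measurable_continuous_onI[OF assms(2)] assms(4) by (simp cong: measurable_cong_sets)
  ultimately show ?thesis
    by (intro integrable_const_bound[where B = B]) auto
qed

text \<open>Distance functions approximate open sets: \<open>min 1 (n * infdist x (- U))\<close>
  tends to 1 on U and vanishes off U. The open sets form an intersection-stable generator of the
  Borel sets.\<close>

lemma borel_measure_eqI_continuous:
  fixes M N :: "'a::metric_space measure"
  assumes M: "M \<in> borel_probs" and N: "N \<in> borel_probs"
    and eq: "\<And>f :: 'a \<Rightarrow> real. continuous_on UNIV f \<Longrightarrow> (\<integral>x. f x \<partial>M) = (\<integral>x. f x \<partial>N)"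
  shows "M = N"
proof -
  define h where "h U n x = min 1 (real n * infdist x (- U))" for U :: "'a set" and n x
  have cont: "continuous_on UNIV (h U n)" for U n
    unfolding h_def by (intro continuous_intros)
  have hb: "\<bar>h U n x\<bar> \<le> 1" for U n x
    unfolding h_def by (auto simp: infdist_nonneg)
  have lim: "(\<lambda>n. h U n x) \<longlonglongrightarrow> indicator U x" if "open U" "U \<noteq> UNIV" for U x
  proof (cases "x \<in> U")
    case True
    have "- U \<noteq> {}" "closed (- U)" using that by auto
    then have pos: "infdist x (- U) > 0"
      using True in_closed_iff_infdist_zero[of "- U" x] infdist_nonneg[of x "- U"] by force
    have "eventually (\<lambda>n. h U n x = 1) sequentially"
      using eventually_ge_at_top[of "nat \<lceil>1 / infdist x (- U)\<rceil>"]
    proof eventually_elim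
      case (elim n)
      then have "1 / infdist x (- U) \<le> real n" by linarith
      then show ?case using pos by (simp add: h_def field_simps)
    qed
    then show ?thesis using True by (simp add: tendsto_eventually)
  next
    case False
    then have "infdist x (- U) = 0" by simp
    then show ?thesis using False by (simp add: h_def)
  qed
  have conv: "(\<lambda>n. \<integral>x. h U n x \<partial>K) \<longlonglongrightarrow> measure K U"
    if "open U" "U \<noteq> UNIV" "K \<in> borel_probs" for U K
  proof -
    note K = borel_probsD[OF that(3)]
    interpret prob_space K by (rule K)
    have [measurable]: "h U n \<in> borel_measurable K" for n
      using borel_measurable_continuous_onI[OF cont] K by (simp cong: measurable_cong_sets)
    have [measurable]: "U \<in> sets K" using that K by simp
    have "(\<lambda>n. \<integral>x. h U n x \<partial>K) \<longlonglongrightarrow> (\<integral>x. indicator U x \<partial>K)"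
      by (rule integral_dominated_convergence[where w = "\<lambda>_. 1"]) (use lim that hb in auto)
    then show ?thesis using K by simp
  qed
  \<comment> \<open>The whole space is treated apart: \<open>infdist x {} = 0\<close> would make the
    approximations vanish there instead of tending to 1.\<close>
  have opn: "emeasure M U = emeasure N U" if "open U" for U
  proof (cases "U = UNIV")
    case True
    then show ?thesis
      using borel_probsD[OF M] borel_probsD[OF N] prob_space.emeasure_space_1 by metis
  next
    case False
    have "measure M U = measure N U"
      using LIMSEQ_unique[OF conv[OF that False M]] conv[OF that False N] eq[OF cont] by simp
    then show ?thesis
      using borel_probsD(1)[OF M] borel_probsD(1)[OF N]
      by (simp add: finite_measure.emeasure_eq_measure prob_space_def)
  qed
  show ?thesis
  proof (rule measure_eqI_generator_eq[where \<Omega> = UNIV and E = "{U. open U}" and A = "\<lambda>_. UNIV"])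
    show "Int_stable {U :: 'a set. open U}" by (auto simp: Int_stable_def)
    show "sets M = sigma_sets UNIV {U. open U}" "sets N = sigma_sets UNIV {U. open U}"
      using borel_probsD[OF M] borel_probsD[OF N] by (simp_all add: borel_def)
    show "emeasure M UNIV \<noteq> \<infinity>" for i :: nat
      using borel_probsD[OF M] prob_space.emeasure_space_1 by fastforce
  qed (use opn in auto)
qed

lemma topspace_weak_star: "topspace weak_star = borel_probs"
  by (auto simp: weak_star_def topspace_pullback_topology)

text \<open>The topology is pulled back along the integration map, so a sequence in its carrier
  converges exactly when its image does, and in a product topology that is convergence of every
  coordinate.\<close>

lemma limitin_weak_star:
  fixes l :: "'a::topological_space measure"
  assumes "\<And>k. z k \<in> borel_probs"
  shows "limitin weak_star z l sequentially \<longleftrightarrow> l \<in> borel_probs \<and>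
    (\<forall>f :: 'a \<Rightarrow> real. continuous_on UNIV f \<longrightarrow> (\<lambda>k. \<integral>x. f x \<partial>z k) \<longlonglongrightarrow> (\<integral>x. f x \<partial>l))"
proof -
  let ?S = "{f :: 'a \<Rightarrow> real. continuous_on UNIV f}"
  let ?I = "\<lambda>M. \<lambda>f\<in>?S. \<integral>x. f x \<partial>M"
  let ?X = "product_topology (\<lambda>_. euclideanreal) ?S"
  have "limitin weak_star z l sequentially \<longleftrightarrow>
      l \<in> borel_probs \<and> limitin ?X (\<lambda>k. ?I (z k)) (?I l) sequentially"
  proof
    assume L: "limitin weak_star z l sequentially"
    then have "l \<in> borel_probs" by (simp add: limitin_def topspace_weak_star)
    moreover have "limitin ?X (\<lambda>k. ?I (z k)) (?I l) sequentially"
      unfolding limitin_def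
    proof (intro conjI allI impI)
      fix U assume U: "openin ?X U \<and> ?I l \<in> U"
      then have "openin weak_star (?I -` U \<inter> borel_probs)"
        unfolding weak_star_def openin_pullback_topology by blast
      then have "eventually (\<lambda>k. z k \<in> ?I -` U \<inter> borel_probs) sequentially"
        using L U \<open>l \<in> borel_probs\<close> unfolding limitin_def by blast
      then show "eventually (\<lambda>k. ?I (z k) \<in> U) sequentially"
        by (rule eventually_mono) simp
    qed auto
    ultimately show "l \<in> borel_probs \<and> limitin ?X (\<lambda>k. ?I (z k)) (?I l) sequentially" ..
  next
    assume R: "l \<in> borel_probs \<and> limitin ?X (\<lambda>k. ?I (z k)) (?I l) sequentially"
    show "limitin weak_star z l sequentially"
      unfolding limitin_def topspace_weak_star
    proof (intro conjI allI impI)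
      fix V assume "openin weak_star V \<and> l \<in> V"
      then obtain U where "openin ?X U" "V = ?I -` U \<inter> borel_probs" "l \<in> V"
        unfolding weak_star_def openin_pullback_topology by blast
      with R show "eventually (\<lambda>k. z k \<in> V) sequentially"
        using assms by (simp add: limitin_def)
    qed (use R in simp)
  qed
  also have "limitin ?X (\<lambda>k. ?I (z k)) (?I l) sequentially \<longleftrightarrow>
      (\<forall>f :: 'a \<Rightarrow> real. continuous_on UNIV f \<longrightarrow> (\<lambda>k. \<integral>x. f x \<partial>z k) \<longlonglongrightarrow> (\<integral>x. f x \<partial>l))"
    by (simp add: limitin_componentwise)
  finally show ?thesis .
qed

text \<open>Integration of continuous functions separates Borel probabilities, and a product of real
  lines is Hausdorff. The point is that compact sets of measures become closed and so contain the
  limits of their own sequences.\<close>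

lemma Hausdorff_space_weak_star:
  "Hausdorff_space (weak_star :: 'a::metric_space measure topology)"
proof -
  let ?S = "{f :: 'a \<Rightarrow> real. continuous_on UNIV f}"
  let ?I = "\<lambda>M. \<lambda>f\<in>?S. \<integral>x. f x \<partial>M"
  let ?X = "product_topology (\<lambda>_. euclideanreal) ?S"
  have "Hausdorff_space ?X" by (simp add: Hausdorff_space_product_topology)
  moreover have "continuous_map weak_star ?X ?I"
    using continuous_map_pullback[OF continuous_map_id, of borel_probs ?I ?X]
    by (simp add: weak_star_def)
  moreover have "inj_on ?I (topspace weak_star)"
  proof (rule inj_onI)
    fix M N :: "'a measure"
    assume "M \<in> topspace weak_star" "N \<in> topspace weak_star" and eq: "?I M = ?I N"
    moreover have "(\<integral>x. f x \<partial>M) = (\<integral>x. f x \<partial>N)" if "continuous_on UNIV f" for f :: "'a \<Rightarrow> real"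
      using fun_cong[OF eq, of f] that by simp
    ultimately show "M = N"
      by (intro borel_measure_eqI_continuous) (auto simp: topspace_weak_star)
  qed
  ultimately show ?thesis by (rule Hausdorff_space_injective_preimage)
qed

section \<open>The covering lemma for tempered sequences\<close>

text \<open>A centre with \<open>y \<in> A #> g\<close> has the form
  \<open>inv h \<otimes> y\<close> with \<open>h \<in> A\<close>. In the greedy selection this caps
  the load that a single scale adds to a point at 1.\<close>

lemma (in group) card_left_translates_le:
  assumes "finite A" "A \<subseteq> carrier G" "y \<in> carrier G"
  shows "finite {g \<in> carrier G. y \<in> A #> g}" "card {g \<in> carrier G. y \<in> A #> g} \<le> card A"
proof -
  have sub: "{g \<in> carrier G. y \<in> A #> g} \<subseteq> (\<lambda>h. inv h \<otimes> y) ` A"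
  proof (safe, goal_cases)
    case (1 g)
    then obtain h where "h \<in> A" "y = h \<otimes> g" by (auto simp: r_coset_def)
    then show ?case using 1 assms(2) by (auto simp: m_assoc[symmetric] subset_iff image_iff intro!: bexI[of _ h])
  qed
  show "finite {g \<in> carrier G. y \<in> A #> g}" using sub assms(1) finite_surj by blast
  show "card {g \<in> carrier G. y \<in> A #> g} \<le> card A" using surj_card_le[OF assms(1) sub] .
qed

locale tempered_seq = group G for G (structure) +
  fixes F :: "nat \<Rightarrow> 'a set" and c :: real
  assumes F: "\<And>k. finite (F k)" "\<And>k. F k \<noteq> {}" "\<And>k. F k \<subseteq> carrier G"
    and c_pos: "c > 0"
    and temp: "\<And>k. real (card (\<Union>j<k. set_inv (F j) <#> F k)) \<le> c * real (card (F k))"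
begin

lemma card_F_pos: "card (F k) > 0"
  using F by (simp add: card_gt_0_iff)

text \<open>The greedy selection runs through the scales in decreasing order. A centre of scale \<open>k\<close> gets the
  mass \<open>1 / card (F k)\<close>, spread over its translate of \<open>F k\<close>, unless this translate already
  contains a point of load at least 1. Fractional masses replace the random selection used in
  Lindenstrauss' covering lemma.\<close>

definition load :: "('a \<Rightarrow> nat) \<Rightarrow> 'a set \<Rightarrow> 'a \<Rightarrow> real" where
  "load \<kappa> P y = (\<Sum>g\<in>{g \<in> P. y \<in> F (\<kappa> g) #> g}. 1 / card (F (\<kappa> g)))"

text \<open>The load stays at most 2 because a translate is accepted only if the larger scales load
  each of its points by less than 1, and all centres of one scale together add at most 1 to a
  point.\<close>

lemma greedy_selection:
  assumes B: "finite B" "B \<subseteq> carrier G" and \<kappa>: "\<And>g. g \<in> B \<Longrightarrow> \<kappa> g \<le> N"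
  obtains P where "P \<subseteq> B" "\<And>y. y \<in> carrier G \<Longrightarrow> load \<kappa> P y \<le> 2"
    "\<And>g. g \<in> B - P \<Longrightarrow> \<exists>y\<in>F (\<kappa> g) #> g. load \<kappa> {g' \<in> P. \<kappa> g < \<kappa> g'} y \<ge> 1"
proof -
  \<comment> \<open>\<open>d\<close> counts the scales already treated, from \<open>N\<close>
    downwards. The form \<open>N < \<kappa> g + d\<close> avoids truncated subtraction, and
    \<open>d = Suc N\<close> covers all of \<open>B\<close>.\<close>
  have "\<exists>P\<subseteq>{g \<in> B. N < \<kappa> g + d}. (\<forall>y\<in>carrier G. load \<kappa> P y \<le> 2) \<and>
     (\<forall>g\<in>{g \<in> B. N < \<kappa> g + d} - P. \<exists>y\<in>F (\<kappa> g) #> g. load \<kappa> {g' \<in> P. \<kappa> g < \<kappa> g'} y \<ge> 1)" for d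
  proof (induction d)
    case 0
    then show ?case using \<kappa> by (intro exI[of _ "{}"]) (auto simp: load_def leD)
  next
    case (Suc d)
    let ?S = "{g \<in> B. N < \<kappa> g + d}"
    obtain P where P: "P \<subseteq> ?S" "\<forall>y\<in>carrier G. load \<kappa> P y \<le> 2"
      "\<forall>g\<in>?S - P. \<exists>y\<in>F (\<kappa> g) #> g. load \<kappa> {g' \<in> P. \<kappa> g < \<kappa> g'} y \<ge> 1"
      using Suc.IH by blast
    \<comment> \<open>All acceptable centres of the scale \<open>N - d\<close> join at once; they
      are tested only against the load of larger scales, not against each other.\<close>
    define Q where "Q = {g \<in> B. \<kappa> g + d = N \<and> (\<forall>y\<in>F (\<kappa> g) #> g. load \<kappa> P y < 1)}"
    have fin: "finite P" "finite Q" using B(1) P(1) finite_subset unfolding Q_def by fastforce+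
    have disj: "P \<inter> Q = {}" using P(1) by (auto simp: Q_def)
    have \<kappa>_Q: "\<kappa> g = N - d" if "g \<in> Q" for g using that by (auto simp: Q_def)
    have add: "load \<kappa> (P \<union> Q) y = load \<kappa> P y + load \<kappa> Q y" for y
      unfolding load_def using fin disj
      by (subst sum.union_disjoint[symmetric]) (auto intro!: sum.cong)
    show ?case
    proof (intro exI[of _ "P \<union> Q"] conjI ballI)
      show "P \<union> Q \<subseteq> {g \<in> B. N < \<kappa> g + Suc d}" using P(1) by (auto simp: Q_def)
    next
      fix y assume y: "y \<in> carrier G"
      show "load \<kappa> (P \<union> Q) y \<le> 2"
      proof (cases "{g \<in> Q. y \<in> F (\<kappa> g) #> g} = {}")
        case True
        then have "load \<kappa> Q y = 0" unfolding load_def by (metis sum.empty)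
        then show ?thesis using P(2) y add by simp
      next
        case False
        then obtain g0 where g0: "g0 \<in> Q" "y \<in> F (\<kappa> g0) #> g0" by blast
        then have lt: "load \<kappa> P y < 1" by (auto simp: Q_def)
        have "load \<kappa> Q y = (\<Sum>g\<in>{g \<in> Q. y \<in> F (\<kappa> g) #> g}. 1 / card (F (N - d)))"
          unfolding load_def by (intro sum.cong) (auto simp: \<kappa>_Q)
        also have "\<dots> = card {g \<in> Q. y \<in> F (\<kappa> g) #> g} / card (F (N - d))" by simp
        also have "\<dots> \<le> card (F (N - d)) / card (F (N - d))"
        proof (intro divide_right_mono)
          have "{g \<in> Q. y \<in> F (\<kappa> g) #> g} \<subseteq> {g \<in> carrier G. y \<in> F (N - d) #> g}"
            using \<kappa>_Q B by (auto simp: Q_def)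
          then have "card {g \<in> Q. y \<in> F (\<kappa> g) #> g} \<le> card {g \<in> carrier G. y \<in> F (N - d) #> g}"
            by (intro card_mono card_left_translates_le F y)
          also have "\<dots> \<le> card (F (N - d))"
            by (intro card_left_translates_le F y)
          finally show "real (card {g \<in> Q. y \<in> F (\<kappa> g) #> g}) \<le> real (card (F (N - d)))" by simp
        qed simp
        also have "\<dots> \<le> 1" by simp
        finally show ?thesis using lt add by simp
      qed
    next
      fix g assume g: "g \<in> {g \<in> B. N < \<kappa> g + Suc d} - (P \<union> Q)"
      show "\<exists>y\<in>F (\<kappa> g) #> g. load \<kappa> {g' \<in> P \<union> Q. \<kappa> g < \<kappa> g'} y \<ge> 1"
      proof (cases "N < \<kappa> g + d")
        case True
        then have "{g' \<in> P \<union> Q. \<kappa> g < \<kappa> g'} = {g' \<in> P. \<kappa> g < \<kappa> g'}"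
          by (auto simp: Q_def)
        then show ?thesis using P(3) g True by simp
      next
        case False
        then have gN: "\<kappa> g + d = N" using g by auto
        then have "{g' \<in> P \<union> Q. \<kappa> g < \<kappa> g'} = P" using P(1) by (auto simp: Q_def)
        then show ?thesis using g gN by (force simp: Q_def not_less)
      qed
    qed
  qed
  from this[of "Suc N"] obtain P where P: "P \<subseteq> {g \<in> B. N < \<kappa> g + Suc N}" "\<forall>y\<in>carrier G. load \<kappa> P y \<le> 2"
     "\<forall>g\<in>{g \<in> B. N < \<kappa> g + Suc N} - P. \<exists>y\<in>F (\<kappa> g) #> g. load \<kappa> {g' \<in> P. \<kappa> g < \<kappa> g'} y \<ge> 1"
    by blast
  have "{g \<in> B. N < \<kappa> g + Suc N} = B" by auto
  then show ?thesis using P that by auto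
qed

text \<open>Double counting of charges. A rejected centre g has a point \<open>y g\<close> of load
  at least 1; it charges \<open>1 / card (F (\<kappa> g'))\<close> to every selected g' of larger
  scale whose translate contains \<open>y g\<close>. Every rejected centre pays at least 1 in total
  and every selected one receives at most \<open>c\<close>, so at most \<open>c * card P\<close>
  centres are rejected.\<close>

lemma card_le_card_selection:
  assumes B: "finite B" "B \<subseteq> carrier G" and P: "P \<subseteq> B"
    and skip: "\<And>g. g \<in> B - P \<Longrightarrow> \<exists>y\<in>F (\<kappa> g) #> g. load \<kappa> {g' \<in> P. \<kappa> g < \<kappa> g'} y \<ge> 1"
  shows "real (card B) \<le> (1 + c) * card P"
proof -
  have fin: "finite P" "finite (B - P)" using B P finite_subset by auto
  obtain y where y: "y g \<in> F (\<kappa> g) #> g" "load \<kappa> {g' \<in> P. \<kappa> g < \<kappa> g'} (y g) \<ge> 1"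
    if "g \<in> B - P" for g
    using skip by metis
  define R where "R g' = {g \<in> B - P. \<kappa> g < \<kappa> g' \<and> y g \<in> F (\<kappa> g') #> g'}" for g'
  have R: "real (card (R g')) \<le> c * card (F (\<kappa> g'))" if g': "g' \<in> P" for g'
  proof -
    let ?U = "\<Union>j<\<kappa> g'. set_inv (F j) <#> F (\<kappa> g')"
    have U: "finite ?U" using F by (auto simp: set_mult_def SET_INV_def)
    \<comment> \<open>From \<open>y g = h \<otimes> g = h' \<otimes> g'\<close> follows
      \<open>g = (inv h \<otimes> h') \<otimes> g'\<close>, and
      \<open>\<kappa> g < \<kappa> g'\<close> places \<open>inv h \<otimes> h'\<close> in the union
      that temperedness bounds.\<close>
    have sub: "R g' \<subseteq> (\<lambda>u. u \<otimes> g') ` ?U"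
    proof
      fix g assume g: "g \<in> R g'"
      then obtain h where h: "h \<in> F (\<kappa> g)" "y g = h \<otimes> g"
        using y(1) by (auto simp: R_def r_coset_def)
      obtain h' where h': "h' \<in> F (\<kappa> g')" "y g = h' \<otimes> g'"
        using g by (auto simp: R_def r_coset_def)
      have car: "h \<in> carrier G" "h' \<in> carrier G" "g \<in> carrier G" "g' \<in> carrier G"
        using h h' F g g' P B by (auto simp: R_def)
      have "g = inv h \<otimes> (h \<otimes> g)" using car by (simp add: m_assoc[symmetric])
      also have "\<dots> = (inv h \<otimes> h') \<otimes> g'" using car h(2) h'(2) by (simp add: m_assoc)
      finally have "g = (inv h \<otimes> h') \<otimes> g'" .
      moreover have "inv h \<otimes> h' \<in> ?U"
        using h h' g by (auto simp: R_def set_mult_def SET_INV_def)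
      ultimately show "g \<in> (\<lambda>u. u \<otimes> g') ` ?U" by blast
    qed
    have "real (card (R g')) \<le> card ?U" using surj_card_le[OF U sub] by simp
    then show ?thesis using temp[of "\<kappa> g'"] by linarith
  qed
  have "real (card (B - P)) \<le> (\<Sum>g\<in>B - P. load \<kappa> {g' \<in> P. \<kappa> g < \<kappa> g'} (y g))"
    using sum_mono[of "B - P" "\<lambda>_. 1::real" "\<lambda>g. load \<kappa> {g' \<in> P. \<kappa> g < \<kappa> g'} (y g)"] y(2) by simp
  also have "\<dots> = (\<Sum>g\<in>B - P. \<Sum>g'\<in>P. if \<kappa> g < \<kappa> g' \<and> y g \<in> F (\<kappa> g') #> g' then 1 / card (F (\<kappa> g')) else 0)"
    unfolding load_def using fin
    by (intro sum.cong[OF refl, where A = "B - P"]) (simp add: sum.inter_filter[symmetric] conj_assoc)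
  also have "\<dots> = (\<Sum>g'\<in>P. \<Sum>g\<in>B - P. if \<kappa> g < \<kappa> g' \<and> y g \<in> F (\<kappa> g') #> g' then 1 / card (F (\<kappa> g')) else 0)"
    by (rule sum.swap)
  also have "\<dots> = (\<Sum>g'\<in>P. card (R g') / card (F (\<kappa> g')))"
    unfolding R_def using fin by (intro sum.cong refl) (simp add: sum.If_cases Int_def)
  also have "\<dots> \<le> (\<Sum>g'\<in>P. c)"
    using R card_F_pos by (intro sum_mono) (simp add: divide_le_eq)
  finally have "real (card (B - P)) \<le> c * card P" by (simp add: mult.commute)
  moreover have "card B = card P + card (B - P)"
    using card_Diff_subset[OF fin(1) P] card_mono[OF B(1) P] by simp
  ultimately show ?thesis by (simp add: algebra_simps)
qed

text \<open>Adding the averages over the selected translates weights each value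
  \<open>\<phi> y\<close> by the load of y, which gives the factor 2 in spite of overlaps. The
  factor \<open>1 + c\<close> pays for the rejected centres.\<close>

lemma weak_type_inequality:
  fixes \<phi> :: "'a \<Rightarrow> real" and l :: real
  assumes B: "finite B" "B \<subseteq> carrier G" and U: "finite U" "U \<subseteq> carrier G" and \<phi>: "\<And>y. y \<in> U \<Longrightarrow> \<phi> y \<ge> 0"
    and ex: "\<And>g. g \<in> B \<Longrightarrow> \<exists>k\<le>N. F k #> g \<subseteq> U \<and> l * card (F k) < (\<Sum>h\<in>F k. \<phi> (h \<otimes> g))"
    and l: "l \<ge> 0"
  shows "l * card B \<le> 2 * (1 + c) * (\<Sum>y\<in>U. \<phi> y)"
proof -
  obtain \<kappa> where \<kappa>: "\<kappa> g \<le> N" "F (\<kappa> g) #> g \<subseteq> U" "l * card (F (\<kappa> g)) < (\<Sum>h\<in>F (\<kappa> g). \<phi> (h \<otimes> g))"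
    if "g \<in> B" for g
    using ex by metis
  obtain P where P: "P \<subseteq> B" "\<And>y. y \<in> carrier G \<Longrightarrow> load \<kappa> P y \<le> 2"
    "\<And>g. g \<in> B - P \<Longrightarrow> \<exists>y\<in>F (\<kappa> g) #> g. load \<kappa> {g' \<in> P. \<kappa> g < \<kappa> g'} y \<ge> 1"
    using greedy_selection[OF B, of \<kappa> N] \<kappa>(1) by blast
  have fin: "finite P" using B P finite_subset by auto
  have tr: "(\<Sum>y\<in>F (\<kappa> g) #> g. \<phi> y) = (\<Sum>h\<in>F (\<kappa> g). \<phi> (h \<otimes> g))" if "g \<in> B" for g
  proof -
    have inj: "inj_on (\<lambda>h. h \<otimes> g) (F (\<kappa> g))"
      using that B F by (auto simp: inj_on_def subset_iff)
    have "F (\<kappa> g) #> g = (\<lambda>h. h \<otimes> g) ` F (\<kappa> g)" by (auto simp: r_coset_def)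
    then show ?thesis using inj by (simp add: sum.reindex)
  qed
  have "l * card P = (\<Sum>g\<in>P. l)" by simp
  also have "\<dots> \<le> (\<Sum>g\<in>P. (1 / card (F (\<kappa> g))) * (\<Sum>y\<in>F (\<kappa> g) #> g. \<phi> y))"
  proof (rule sum_mono)
    fix g assume "g \<in> P"
    then have "g \<in> B" using P by auto
    then show "l \<le> (1 / card (F (\<kappa> g))) * (\<Sum>y\<in>F (\<kappa> g) #> g. \<phi> y)"
      using \<kappa>(3)[of g] tr[of g] card_F_pos[of "\<kappa> g"] by (simp add: field_simps)
  qed
  also have "\<dots> = (\<Sum>g\<in>P. \<Sum>y\<in>U. if y \<in> F (\<kappa> g) #> g then \<phi> y * (1 / card (F (\<kappa> g))) else 0)"
  proof (intro sum.cong refl)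
    fix g assume "g \<in> P"
    then have "F (\<kappa> g) #> g = {y \<in> U. y \<in> F (\<kappa> g) #> g}" using P(1) \<kappa>(2)[of g] by blast
    then show "(1 / card (F (\<kappa> g))) * (\<Sum>y\<in>F (\<kappa> g) #> g. \<phi> y) = (\<Sum>y\<in>U. if y \<in> F (\<kappa> g) #> g then \<phi> y * (1 / card (F (\<kappa> g))) else 0)"
      using U by (simp add: sum.If_cases Int_def sum_divide_distrib)
  qed
  also have "\<dots> = (\<Sum>y\<in>U. \<Sum>g\<in>P. if y \<in> F (\<kappa> g) #> g then \<phi> y * (1 / card (F (\<kappa> g))) else 0)"
    by (rule sum.swap)
  also have "\<dots> = (\<Sum>y\<in>U. \<phi> y * load \<kappa> P y)"
    unfolding load_def using fin
    by (intro sum.cong refl) (simp add: sum.If_cases Int_def sum_distrib_left)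
  also have "\<dots> \<le> (\<Sum>y\<in>U. \<phi> y * 2)"
    using P(2) U \<phi> by (intro sum_mono mult_left_mono) auto
  finally have "l * card P \<le> 2 * (\<Sum>y\<in>U. \<phi> y)" by (simp add: sum_distrib_right[symmetric])
  then have "(1 + c) * (l * card P) \<le> (1 + c) * (2 * (\<Sum>y\<in>U. \<phi> y))"
    using c_pos by (intro mult_left_mono) auto
  moreover have "l * card B \<le> l * ((1 + c) * card P)"
    using card_le_card_selection[OF B P(1) P(3)] l by (intro mult_left_mono) auto
  ultimately show ?thesis by (simp add: algebra_simps)
qed

end

section \<open>The maximal inequality\<close>

locale tempered_action = tempered_seq G F c + group_action G UNIV T
  for G (structure) and F :: "nat \<Rightarrow> 'a set" and c :: real and T :: "'a \<Rightarrow> 'x::metric_space \<Rightarrow> 'x" +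
  assumes compact_space: "compact (UNIV :: 'x set)"
    and continuous_T: "g \<in> carrier G \<Longrightarrow> continuous_on UNIV (T g)"
    and folner: "g \<in> carrier G \<Longrightarrow>
      (\<lambda>k. real (card (sym_diff (F k) (g <# F k))) / real (card (F k))) \<longlonglongrightarrow> 0"
begin

definition avg :: "nat \<Rightarrow> ('x \<Rightarrow> real) \<Rightarrow> 'x \<Rightarrow> real" where
  "avg k f x = (\<Sum>g\<in>F k. f (T g x)) / card (F k)"

lemma F_carrier: "g \<in> F k \<Longrightarrow> g \<in> carrier G"
  using F(3) by blast

lemma T_mult: "g \<in> carrier G \<Longrightarrow> h \<in> carrier G \<Longrightarrow> T (g \<otimes> h) x = T g (T h x)"
  by (simp add: composition_rule)

lemma continuous_comp_T: "continuous_on UNIV f \<Longrightarrow> g \<in> carrier G \<Longrightarrow> continuous_on UNIV (\<lambda>x. f (T g x))"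
  using continuous_on_compose2[OF _ continuous_T] by blast

lemma continuous_avg: "continuous_on UNIV f \<Longrightarrow> continuous_on UNIV (avg k f)"
  unfolding avg_def using card_F_pos[of k]
  by (intro continuous_intros continuous_comp_T) (auto dest: F_carrier)

lemma measurable_T: "g \<in> carrier G \<Longrightarrow> T g \<in> borel_measurable borel"
  using borel_measurable_continuous_onI[OF continuous_T] .

lemma avg_add: "avg k (\<lambda>x. f x + h x) x = avg k f x + avg k h x"
  by (simp add: avg_def sum.distrib add_divide_distrib)

lemma avg_diff: "avg k (\<lambda>x. f x - h x) x = avg k f x - avg k h x"
  by (simp add: avg_def sum_subtractf diff_divide_distrib)

lemma avg_cmult: "avg k (\<lambda>x. r * f x) x = r * avg k f x"
  by (simp add: avg_def sum_distrib_left)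

lemma avg_const: "avg k (\<lambda>x. r) x = r"
  using card_F_pos[of k] by (simp add: avg_def)

lemma avg_sum: "avg k (\<lambda>x. \<Sum>i\<in>I. f i x) x = (\<Sum>i\<in>I. avg k (f i) x)"
  unfolding avg_def sum_divide_distrib[symmetric] by (simp add: sum.swap[of _ I])

lemma abs_avg_le: "\<bar>avg k f x\<bar> \<le> avg k (\<lambda>x. \<bar>f x\<bar>) x"
  unfolding avg_def by (simp add: divide_right_mono)

lemma avg_mono: "(\<And>x. f x \<le> h x) \<Longrightarrow> avg k f x \<le> avg k h x"
  unfolding avg_def by (simp add: divide_right_mono sum_mono)

lemma invariant_measuresD:
  assumes "M \<in> invariant_measures G T"
  shows "M \<in> borel_probs" "prob_space M" "sets M = sets borel" "space M = UNIV"
    "g \<in> carrier G \<Longrightarrow> distr M borel (T g) = M"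
proof -
  show M: "M \<in> borel_probs" using assms by (simp add: invariant_measures_def)
  then show *: "prob_space M" "sets M = sets borel" "space M = UNIV" by (rule borel_probsD)+
  assume g: "g \<in> carrier G"
  show "distr M borel (T g) = M"
  proof (rule measure_eqI)
    fix A assume "A \<in> sets (distr M borel (T g))"
    then show "emeasure (distr M borel (T g)) A = emeasure M A"
      using assms g * measurable_T[OF g]
      by (simp add: emeasure_distr invariant_measures_def cong: measurable_cong_sets)
  qed (use * in simp)
qed

lemma integral_comp_T:
  fixes f :: "'x \<Rightarrow> real"
  assumes "M \<in> invariant_measures G T" "g \<in> carrier G" "f \<in> borel_measurable borel"
  shows "(\<integral>x. f (T g x) \<partial>M) = (\<integral>x. f x \<partial>M)"
proof -
  have "T g \<in> measurable M borel"
    using measurable_T[OF assms(2)] invariant_measuresD(3)[OF assms(1)] by (simp cong: measurable_cong_sets)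
  then have "(\<integral>x. f (T g x) \<partial>M) = (\<integral>x. f x \<partial>distr M borel (T g))"
    using assms(3) by (simp add: integral_distr)
  then show ?thesis by (simp add: invariant_measuresD(5)[OF assms(1,2)])
qed

lemma integrable_cont:
  fixes f :: "'x \<Rightarrow> real"
  assumes "M \<in> invariant_measures G T" "continuous_on UNIV f"
  shows "integrable M f"
  using invariant_measuresD[OF assms(1)] assms(2) compact_space
  by (intro integrable_continuous) (auto simp: prob_space_def)

lemma finite_l_coset: "finite A \<Longrightarrow> finite (g <# A)"
  by (simp add: l_coset_def)

text \<open>Elements of \<open>K <#> F m\<close> outside \<open>F m\<close> lie in one of finitely
  many symmetric differences, each of relative size tending to 0. So enlarging \<open>F m\<close> by
  a fixed finite set costs nothing in the limit.\<close>

lemma card_set_mult_F_le: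
  assumes "finite K" "K \<subseteq> carrier G"
  shows "real (card (K <#> F m)) \<le> card (F m) + (\<Sum>g\<in>K. real (card (sym_diff (F m) (g <# F m))))"
proof -
  have "K <#> F m \<subseteq> F m \<union> (\<Union>g\<in>K. sym_diff (F m) (g <# F m))"
    by (auto simp: set_mult_def l_coset_def)
  then have "card (K <#> F m) \<le> card (F m \<union> (\<Union>g\<in>K. sym_diff (F m) (g <# F m)))"
    using assms F by (intro card_mono) (auto simp: finite_l_coset)
  also have "\<dots> \<le> card (F m) + card (\<Union>g\<in>K. sym_diff (F m) (g <# F m))" by (rule card_Un_le)
  also have "card (\<Union>g\<in>K. sym_diff (F m) (g <# F m)) \<le> (\<Sum>g\<in>K. card (sym_diff (F m) (g <# F m)))"
    using assms(1) by (rule card_UN_le)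
  finally show ?thesis by (simp flip: of_nat_sum)
qed

text \<open>Transference: for fixed x the inequality on the group is applied to
  \<open>\<lambda>y. u (T y x)\<close> on \<open>K <#> F m\<close>, with the times in
  \<open>F m\<close> at which the orbit visits \<open>E\<close> as centres. Integrating over x turns
  every term on the left into \<open>measure M E\<close> and every term on the right into the
  integral of \<open>u\<close>; after division by \<open>card (F m)\<close> the Folner condition
  removes the excess of \<open>K <#> F m\<close>.\<close>

lemma maximal_inequality_finite:
  fixes u :: "'x \<Rightarrow> real" and l :: real
  assumes M: "M \<in> invariant_measures G T" and u: "continuous_on UNIV u" "\<And>x. u x \<ge> 0" and l: "l \<ge> 0"
  shows "l * measure M {x. \<exists>k\<le>N. l < avg k u x} \<le> 2 * (1 + c) * (\<integral>x. u x \<partial>M)"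
proof -
  note MD = invariant_measuresD[OF M]
  interpret prob_space M by (rule MD)
  define E where "E = {x. \<exists>k\<le>N. l < avg k u x}"
  \<comment> \<open>Finitely many scales keep \<open>K\<close> finite, so that the Folner sets can
    absorb it; \<open>K <#> F m\<close> contains every \<open>F k #> g\<close> with
    \<open>k \<le> N\<close> and \<open>g \<in> F m\<close>.\<close>
  define K where "K = (\<Union>k\<le>N. F k)"
  have K: "finite K" "K \<subseteq> carrier G" using F by (auto simp: K_def)
  have [measurable]: "avg k u \<in> borel_measurable borel" "u \<in> borel_measurable borel" for k
    using borel_measurable_continuous_onI continuous_avg u by blast+
  have E: "E \<in> sets borel" unfolding E_def by measurable
  have pointwise: "l * (\<Sum>g\<in>F m. indicator E (T g x)) \<le> 2 * (1 + c) * (\<Sum>y\<in>K <#> F m. u (T y x))" for m x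
  proof -
    have "l * card {g \<in> F m. T g x \<in> E} \<le> 2 * (1 + c) * (\<Sum>y\<in>K <#> F m. u (T y x))"
    proof (rule weak_type_inequality)
      fix g assume "g \<in> {g \<in> F m. T g x \<in> E}"
      then obtain k where k: "g \<in> F m" "k \<le> N" "l < avg k u (T g x)" by (auto simp: E_def)
      then have "l * card (F k) < (\<Sum>h\<in>F k. u (T h (T g x)))"
        using card_F_pos[of k] by (simp add: avg_def field_simps)
      also have "\<dots> = (\<Sum>h\<in>F k. u (T (h \<otimes> g) x))"
        using k by (intro sum.cong) (auto simp: T_mult F_carrier)
      finally show "\<exists>k\<le>N. F k #> g \<subseteq> K <#> F m \<and> l * card (F k) < (\<Sum>h\<in>F k. u (T (h \<otimes> g) x))"
        using k by (intro exI[of _ k]) (auto simp: r_coset_def set_mult_def K_def)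
    next
      show "finite (K <#> F m)" using K F by (auto simp: set_mult_def)
      show "K <#> F m \<subseteq> carrier G" using K F by (auto simp: set_mult_def F_carrier subset_iff)
    qed (use F u l in auto)
    also have "real (card {g \<in> F m. T g x \<in> E}) = (\<Sum>g\<in>F m. indicator E (T g x))"
      using F by (simp add: indicator_def sum.If_cases Int_def)
    finally show ?thesis .
  qed
  have fin_set: "l * measure M E \<le> 2 * (1 + c) *
      (1 + (\<Sum>g\<in>K. card (sym_diff (F m) (g <# F m)) / card (F m))) * (\<integral>x. u x \<partial>M)" for m
  proof -
    have int1: "integrable M (\<lambda>x. indicator E (T g x) :: real)" if "g \<in> F m" for g
    proof -
      have [measurable]: "T g \<in> measurable M borel"
        using measurable_T[OF F_carrier[OF that]] MD(3) by (simp cong: measurable_cong_sets)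
      note E[measurable]
      show ?thesis by (intro integrable_const_bound[where B = 1]) auto
    qed
    have y_carrier: "y \<in> carrier G" if "y \<in> K <#> F m" for y
      using that K by (auto simp: set_mult_def F_carrier subset_iff)
    have int2: "integrable M (\<lambda>x. u (T y x))" if "y \<in> K <#> F m" for y
      by (intro integrable_cont M continuous_comp_T u y_carrier that)
    have "card (F m) * (l * measure M E) = l * (\<Sum>g\<in>F m. \<integral>x. indicator E (T g x) \<partial>M)"
    proof -
      have "(\<integral>x. indicator E (T g x) \<partial>M) = measure M E" if "g \<in> F m" for g
        using integral_comp_T[OF M F_carrier[OF that], of "indicator E"] E MD(3,4)
        by simp
      then show ?thesis by simp
    qed
    also have "\<dots> = (\<integral>x. l * (\<Sum>g\<in>F m. indicator E (T g x)) \<partial>M)"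
      using int1 by simp
    also have "\<dots> \<le> (\<integral>x. 2 * (1 + c) * (\<Sum>y\<in>K <#> F m. u (T y x)) \<partial>M)"
      using int1 int2 pointwise by (intro integral_mono) auto
    also have "\<dots> = 2 * (1 + c) * (\<Sum>y\<in>K <#> F m. \<integral>x. u (T y x) \<partial>M)"
      using int2 by simp
    also have "\<dots> = 2 * (1 + c) * (card (K <#> F m) * (\<integral>x. u x \<partial>M))"
      using integral_comp_T[OF M y_carrier, of _ u] by simp
    also have "\<dots> \<le> 2 * (1 + c) * ((card (F m) + (\<Sum>g\<in>K. real (card (sym_diff (F m) (g <# F m))))) * (\<integral>x. u x \<partial>M))"
      using card_set_mult_F_le[OF K] c_pos u(2)
      by (intro mult_left_mono mult_right_mono integral_nonneg_AE) auto
    finally show ?thesis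
      using card_F_pos[of m] by (simp add: field_simps sum_divide_distrib[symmetric])
  qed
  have "(\<lambda>m. 2 * (1 + c) * (1 + (\<Sum>g\<in>K. card (sym_diff (F m) (g <# F m)) / card (F m))) * (\<integral>x. u x \<partial>M))
      \<longlonglongrightarrow> 2 * (1 + c) * (1 + (\<Sum>g\<in>K. 0)) * (\<integral>x. u x \<partial>M)"
    using K by (intro tendsto_intros folner) auto
  then have "l * measure M E \<le> 2 * (1 + c) * (1 + (\<Sum>g\<in>K. 0)) * (\<integral>x. u x \<partial>M)"
    by (rule LIMSEQ_le_const) (use fin_set in blast)
  then show ?thesis by (simp add: E_def)
qed

text \<open>The constant does not depend on the number of scales, so continuity of the measure from
  below suffices.\<close>

lemma maximal_inequality:
  fixes u :: "'x \<Rightarrow> real" and l :: real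
  assumes M: "M \<in> invariant_measures G T" and u: "continuous_on UNIV u" "\<And>x. u x \<ge> 0" and l: "l \<ge> 0"
  shows "l * measure M {x. \<exists>k. l < avg k u x} \<le> 2 * (1 + c) * (\<integral>x. u x \<partial>M)"
proof -
  note MD = invariant_measuresD[OF M]
  interpret prob_space M by (rule MD)
  have [measurable]: "avg k u \<in> borel_measurable M" for k
    using borel_measurable_continuous_onI[OF continuous_avg[OF u(1)], of k] MD(3) by (simp cong: measurable_cong_sets)
  have "(\<lambda>N. measure M {x \<in> space M. \<exists>k\<le>N. l < avg k u x})
      \<longlonglongrightarrow> measure M (\<Union>N. {x \<in> space M. \<exists>k\<le>N. l < avg k u x})"
    by (intro finite_Lim_measure_incseq) (auto simp: incseq_def intro: order_trans)
  moreover have "(\<Union>N. {x \<in> space M. \<exists>k\<le>N. l < avg k u x}) = {x. \<exists>k. l < avg k u x}"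
    using MD(4) by auto
  ultimately have "(\<lambda>N. l * measure M {x. \<exists>k\<le>N. l < avg k u x}) \<longlonglongrightarrow> l * measure M {x. \<exists>k. l < avg k u x}"
    using MD(4) by (simp add: tendsto_mult_left)
  then show ?thesis
    by (rule LIMSEQ_le_const2) (use maximal_inequality_finite[OF assms] in blast)
qed

section \<open>Averages of coboundaries and the convex hull of translates\<close>

lemma avg_coboundary:
  assumes u: "\<And>x. \<bar>u x\<bar> \<le> B" and g: "g \<in> carrier G"
  shows "\<bar>avg k u x - avg k (\<lambda>x. u (T g x)) x\<bar> \<le> B * (card (sym_diff (F k) (g <# F k)) / card (F k))"
proof -
  let ?A = "F k" and ?A' = "g <# F k" and ?\<phi> = "\<lambda>y. u (T y x)"
  have fin: "finite ?A" "finite ?A'" using F finite_l_coset by auto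
  have "(\<Sum>h\<in>?A. u (T g (T h x))) = (\<Sum>h\<in>?A. ?\<phi> (g \<otimes> h))"
    using g by (intro sum.cong) (auto simp: T_mult F_carrier)
  also have "\<dots> = (\<Sum>y\<in>?A'. ?\<phi> y)"
  proof -
    have "inj_on (\<lambda>h. g \<otimes> h) ?A"
      using g F_carrier by (auto simp: inj_on_def)
    moreover have "?A' = (\<lambda>h. g \<otimes> h) ` ?A" by (auto simp: l_coset_def)
    ultimately show ?thesis by (simp add: sum.reindex)
  qed
  \<comment> \<open>Both sums evaluate one function on the group, over \<open>F k\<close> and over
    \<open>g <# F k\<close>; the common part cancels and the symmetric difference is left.\<close>
  finally have "\<bar>(\<Sum>h\<in>?A. u (T h x)) - (\<Sum>h\<in>?A. u (T g (T h x)))\<bar> = \<bar>sum ?\<phi> (?A - ?A') - sum ?\<phi> (?A' - ?A)\<bar>"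
    using sum.Int_Diff[OF fin(1), of ?\<phi> ?A'] sum.Int_Diff[OF fin(2), of ?\<phi> ?A] by (simp add: Int_commute)
  also have "\<dots> \<le> (\<Sum>y\<in>?A - ?A'. \<bar>?\<phi> y\<bar>) + (\<Sum>y\<in>?A' - ?A. \<bar>?\<phi> y\<bar>)"
    using sum_abs[of ?\<phi> "?A - ?A'"] sum_abs[of ?\<phi> "?A' - ?A"] by linarith
  also have "\<dots> = (\<Sum>y\<in>sym_diff ?A ?A'. \<bar>?\<phi> y\<bar>)"
    using fin by (subst sum.union_disjoint) auto
  also have "\<dots> \<le> (\<Sum>y\<in>sym_diff ?A ?A'. B)" using u by (intro sum_mono) auto
  finally have "\<bar>(\<Sum>h\<in>?A. u (T h x)) - (\<Sum>h\<in>?A. u (T g (T h x)))\<bar> \<le> B * card (sym_diff ?A ?A')"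
    by (simp add: mult.commute)
  then show ?thesis
    using card_F_pos[of k] by (simp add: avg_def field_simps flip: diff_divide_distrib)
qed

text \<open>These are the dyadic convex combinations of translates. Midpoints are all that the
  parallelogram law asks for, and the members remain continuous, so the maximal inequality applies
  to them.\<close>

inductive_set translate_hull :: "('x \<Rightarrow> real) \<Rightarrow> ('x \<Rightarrow> real) set" for f where
  base: "f \<in> translate_hull f"
| translate: "u \<in> translate_hull f \<Longrightarrow> g \<in> carrier G \<Longrightarrow> (\<lambda>x. u (T g x)) \<in> translate_hull f"
| midpoint: "u \<in> translate_hull f \<Longrightarrow> v \<in> translate_hull f \<Longrightarrow> (\<lambda>x. (u x + v x) / 2) \<in> translate_hull f"

lemma translate_hull_continuous:
  assumes "u \<in> translate_hull f" "continuous_on UNIV f"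
  shows "continuous_on UNIV u"
  using assms by induction (auto intro!: continuous_intros continuous_comp_T)

lemma translate_hull_bounds:
  assumes "u \<in> translate_hull f" "\<And>x. a \<le> f x" "\<And>x. f x \<le> b"
  shows "a \<le> u x" "u x \<le> b"
proof -
  have "\<forall>x. a \<le> u x \<and> u x \<le> b"
    using assms(1)
  proof induction
    case (midpoint u v)
    show ?case
    proof
      fix x
      have "a \<le> u x" "u x \<le> b" "a \<le> v x" "v x \<le> b" using midpoint.IH by auto
      then show "a \<le> (u x + v x) / 2 \<and> (u x + v x) / 2 \<le> b" by auto
    qed
  qed (use assms in auto)
  then show "a \<le> u x" "u x \<le> b" by auto
qed

lemma translate_hull_integral:
  assumes "u \<in> translate_hull f" "continuous_on UNIV f" "M \<in> invariant_measures G T"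
  shows "(\<integral>x. u x \<partial>M) = (\<integral>x. f x \<partial>M)"
  using assms(1)
proof induction
  case (translate u g)
  then show ?case
    using integral_comp_T[OF assms(3)] translate_hull_continuous[OF _ assms(2)] borel_measurable_continuous_onI
    by metis
next
  case (midpoint u v)
  then have "integrable M u" "integrable M v"
    using integrable_cont[OF assms(3)] translate_hull_continuous[OF _ assms(2)] by auto
  then show ?case using midpoint by simp
qed simp

text \<open>Every translation changes the averages by those of a coboundary, which tend to 0
  uniformly. Uniformity in x allows \<open>f\<close> to be traded for a member of its hull at all
  points at once.\<close>

lemma translate_hull_avg:
  assumes "u \<in> translate_hull f" "continuous_on UNIV f" "e > 0"
  shows "\<forall>\<^sub>F k in sequentially. \<forall>x. \<bar>avg k f x - avg k u x\<bar> < e"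
  using assms(1,3)
proof (induction arbitrary: e)
  case base
  then show ?case by simp
next
  case (translate u g)
  obtain B where B: "B > 0" "\<And>x. \<bar>u x\<bar> \<le> B"
    using continuous_on_UNIV_abs_bounded[OF compact_space translate_hull_continuous[OF translate(1) assms(2)]]
    by blast
  have "(\<lambda>k. B * (card (sym_diff (F k) (g <# F k)) / card (F k))) \<longlonglongrightarrow> B * 0"
    by (intro tendsto_intros folner translate)
  then have "\<forall>\<^sub>F k in sequentially. B * (card (sym_diff (F k) (g <# F k)) / card (F k)) < e / 2"
    using translate.prems by (intro order_tendstoD) auto
  moreover have "\<forall>\<^sub>F k in sequentially. \<forall>x. \<bar>avg k f x - avg k u x\<bar> < e / 2"
    using translate.prems by (intro translate.IH) auto
  ultimately show ?case
  proof eventually_elim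
    case (elim k)
    show ?case
    proof
      fix x
      have "\<bar>avg k u x - avg k (\<lambda>x. u (T g x)) x\<bar> < e / 2"
        using avg_coboundary[of u, OF B(2) translate(2), of k x] elim(1) by linarith
      then show "\<bar>avg k f x - avg k (\<lambda>x. u (T g x)) x\<bar> < e" using elim(2)[rule_format, of x] by linarith
    qed
  qed
next
  case (midpoint u v)
  have eq: "avg k (\<lambda>x. (u x + v x) / 2) x = (avg k u x + avg k v x) / 2" for k x
    using avg_cmult[of k "1/2" "\<lambda>x. u x + v x" x] avg_add[of k u v x] by simp
  from midpoint.IH(1)[OF midpoint.prems] midpoint.IH(2)[OF midpoint.prems] show ?case
  proof eventually_elim
    case (elim k)
    show ?case
    proof
      fix x
      show "\<bar>avg k f x - avg k (\<lambda>x. (u x + v x) / 2) x\<bar> < e"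
        using elim(1)[rule_format, of x] elim(2)[rule_format, of x] unfolding eq abs_less_iff by argo
    qed
  qed
qed

end

section \<open>The mean ergodic theorem\<close>

lemma (in prob_space) square_integral_abs_le:
  fixes v :: "'a \<Rightarrow> real"
  assumes "integrable M v" "integrable M (\<lambda>x. (v x)\<^sup>2)"
  shows "(\<integral>x. \<bar>v x\<bar> \<partial>M)\<^sup>2 \<le> (\<integral>x. (v x)\<^sup>2 \<partial>M)"
  using variance_positive[of "\<lambda>x. \<bar>v x\<bar>"] variance_eq[of "\<lambda>x. \<bar>v x\<bar>"] assms by simp

section \<open>Invariant densities and extremality\<close>

context tempered_action
begin

text \<open>The assumption on indicators is invariance of the measure with density \<open>w\<close>,
  written with integrals because the limit of a minimising sequence delivers it in that
  form.\<close>

lemma density_invariant: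
  fixes w :: "'x \<Rightarrow> real"
  assumes M: "M \<in> invariant_measures G T" and [measurable]: "w \<in> borel_measurable borel"
    and w: "\<And>x. 0 \<le> w x" "\<And>x. w x \<le> B" and a: "a > 0" "(\<integral>x. w x \<partial>M) = a"
    and inv: "\<And>g A. g \<in> carrier G \<Longrightarrow> A \<in> sets borel \<Longrightarrow>
       (\<integral>x. indicator (T g -` A) x * w x \<partial>M) = (\<integral>x. indicator A x * w x \<partial>M)"
  obtains N where "N \<in> invariant_measures G T"
    "\<And>A. A \<in> sets borel \<Longrightarrow> measure N A = (\<integral>x. indicator A x * w x \<partial>M) / a"
proof -
  note MD = invariant_measuresD[OF M]
  interpret prob_space M by (rule MD)
  define N where "N = density M (\<lambda>x. ennreal (w x / a))"
  have [measurable]: "w \<in> borel_measurable M" using assms(2) MD(3) by (simp cong: measurable_cong_sets)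
  have sN: "sets N = sets borel" "space N = UNIV" by (simp_all add: N_def MD)
  have em: "emeasure N A = ennreal ((\<integral>x. indicator A x * w x \<partial>M) / a)" if "A \<in> sets borel" for A
  proof -
    have [measurable]: "A \<in> sets M" using that MD by simp
    have int: "integrable M (\<lambda>x. indicator A x * w x / a)"
      using w a order_trans[OF w(1) w(2)] by (intro integrable_const_bound[where B = "B / a"] AE_I2)
        (auto simp: indicator_def divide_right_mono)
    have "emeasure N A = (\<integral>\<^sup>+x. ennreal (w x / a) * indicator A x \<partial>M)"
      by (simp add: N_def emeasure_density)
    also have "\<dots> = (\<integral>\<^sup>+x. ennreal (indicator A x * w x / a) \<partial>M)"
      by (intro nn_integral_cong) (auto simp: indicator_def)
    also have "\<dots> = ennreal (\<integral>x. indicator A x * w x / a \<partial>M)"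
      using int w a by (intro nn_integral_eq_integral) auto
    finally show ?thesis by simp
  qed
  have "prob_space N"
    using em[of UNIV] a by (intro prob_spaceI) (simp add: sN)
  moreover have "emeasure N (T g -` A) = emeasure N A" if "g \<in> carrier G" "A \<in> sets borel" for g A
  proof -
    have "T g -` A \<in> sets borel" using measurable_sets[OF measurable_T[OF that(1)] that(2)] by simp
    then show ?thesis using that by (simp add: em inv)
  qed
  ultimately have "N \<in> invariant_measures G T"
    by (simp add: invariant_measures_def borel_probs_def sN)
  moreover have "measure N A = (\<integral>x. indicator A x * w x \<partial>M) / a" if "A \<in> sets borel" for A
    using em[OF that] w a by (simp add: measure_def integral_nonneg_AE)
  ultimately show ?thesis using that by blast
qed

text \<open>\<open>M\<close> is the convex combination, with coefficients a and 1 - a, of the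
  invariant measures with densities w / a and (1 - w) / (1 - a). Extremality makes the two equal,
  hence equal to \<open>M\<close>, so w has mean a on every set of positive measure. The bounds keep
  both densities nonnegative and a strictly between 0 and 1.\<close>

lemma invariant_density_const:
  fixes w :: "'x \<Rightarrow> real"
  assumes M: "M \<in> extreme_measures (invariant_measures G T)" and w_meas: "w \<in> borel_measurable borel"
    and w: "\<And>x. 1/4 \<le> w x" "\<And>x. w x \<le> 3/4"
    and inv: "\<And>g A. g \<in> carrier G \<Longrightarrow> A \<in> sets borel \<Longrightarrow>
       (\<integral>x. indicator (T g -` A) x * w x \<partial>M) = (\<integral>x. indicator A x * w x \<partial>M)"
  shows "(\<integral>x. \<bar>w x - (\<integral>x. w x \<partial>M)\<bar> \<partial>M) = 0"
proof -
  have Mi: "M \<in> invariant_measures G T" using M by (simp add: extreme_measures_def)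
  note MD = invariant_measuresD[OF Mi]
  interpret prob_space M by (rule MD)
  have w_M[measurable]: "w \<in> borel_measurable M" using w_meas MD(3) by (simp cong: measurable_cong_sets)
  note w_meas[measurable]
  have wb: "\<bar>w x\<bar> \<le> 1" for x using w[of x] by auto
  have int_w: "integrable M w" using wb by (intro integrable_const_bound[where B = 1]) auto
  have int_A: "integrable M (\<lambda>x. indicator A x * w x)" "integrable M (indicator A :: 'x \<Rightarrow> real)"
    if "A \<in> sets borel" for A
  proof -
    have [measurable]: "A \<in> sets M" using that MD by simp
    show "integrable M (\<lambda>x. indicator A x * w x)"
      using wb by (intro integrable_const_bound[where B = 1]) (auto simp: indicator_def)
    show "integrable M (indicator A :: 'x \<Rightarrow> real)"
      by (intro integrable_const_bound[where B = 1]) auto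
  qed
  define a where "a = (\<integral>x. w x \<partial>M)"
  have "(\<integral>x. 1/4 \<partial>M) \<le> a" "a \<le> (\<integral>x. 3/4 \<partial>M)"
    unfolding a_def using w int_w by (intro integral_mono; simp)+
  then have a: "1/4 \<le> a" "a \<le> 3/4" by (simp_all add: prob_space)
  obtain N1 where N1: "N1 \<in> invariant_measures G T"
    "\<And>A. A \<in> sets borel \<Longrightarrow> measure N1 A = (\<integral>x. indicator A x * w x \<partial>M) / a"
    by (rule density_invariant[OF Mi w_meas _ w(2), of a]) (use w a inv in \<open>auto simp: a_def intro: order_trans[of 0 "1/4"]\<close>)
  have compl: "(\<integral>x. indicator A x * (1 - w x) \<partial>M) = measure M A - (\<integral>x. indicator A x * w x \<partial>M)"
    if "A \<in> sets borel" for A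
    using int_A[OF that] that MD(3,4) by (simp add: right_diff_distrib)
  have meas_T: "T g -` A \<in> sets borel" "measure M (T g -` A) = measure M A" if "g \<in> carrier G" "A \<in> sets borel" for g A
  proof -
    show "T g -` A \<in> sets borel" using measurable_sets[OF measurable_T[OF that(1)] that(2)] by simp
    show "measure M (T g -` A) = measure M A" using Mi that by (simp add: invariant_measures_def measure_def)
  qed
  obtain N2 where N2: "N2 \<in> invariant_measures G T"
    "\<And>A. A \<in> sets borel \<Longrightarrow> measure N2 A = (\<integral>x. indicator A x * (1 - w x) \<partial>M) / (1 - a)"
  proof (rule density_invariant[OF Mi, of "\<lambda>x. 1 - w x" 1 "1 - a"])
    show "0 \<le> 1 - w x" "1 - w x \<le> 1" for x using w[of x] by auto
    show "(\<integral>x. 1 - w x \<partial>M) = 1 - a" using int_w by (simp add: a_def prob_space)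
    show "(\<integral>x. indicator (T g -` A) x * (1 - w x) \<partial>M) = (\<integral>x. indicator A x * (1 - w x) \<partial>M)"
      if "g \<in> carrier G" "A \<in> sets borel" for g A
      using that inv by (simp add: compl meas_T)
  qed (use a in auto)
  \<comment> \<open>The coefficients are written with t = 1 - a to match the shape used in
    \<open>extreme_measures\<close>.\<close>
  have comb: "measure M A = (1 - (1 - a)) * measure N1 A + (1 - a) * measure N2 A" if "A \<in> sets borel" for A
    using that a by (simp add: N1(2) N2(2) compl)
  have "N1 = N2"
  proof (rule ccontr)
    assume "N1 \<noteq> N2"
    moreover have "0 < 1 - a" "1 - a < 1" using a by auto
    ultimately show False
      using M N1(1) N2(1) comb unfolding extreme_measures_def by blast
  qed
  then have w_A: "(\<integral>x. indicator A x * w x \<partial>M) = a * measure M A" if "A \<in> sets borel" for A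
    using comb[OF that] N1(2)[OF that] a by (simp add: algebra_simps)
  \<comment> \<open>On this set w - a is positive and off it w - a is at most 0, so
    \<open>\<bar>w - a\<bar>\<close> equals twice w - a restricted to \<open>A\<close>, minus w - a;
    both parts integrate to 0.\<close>
  define A where "A = {x. a < w x}"
  have A: "A \<in> sets borel" unfolding A_def by measurable
  have "(\<integral>x. \<bar>w x - a\<bar> \<partial>M) = (\<integral>x. 2 * (indicator A x * w x - a * indicator A x) - (w x - a) \<partial>M)"
    by (intro Bochner_Integration.integral_cong) (auto simp: A_def indicator_def)
  also have "\<dots> = 2 * (a * measure M A - a * measure M A) - (a - a)"
    using int_A[OF A] int_w w_A[OF A] A MD(3,4) prob_space by (simp add: a_def[symmetric])
  finally show ?thesis by (simp add: a_def)
qed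

text \<open>The von Neumann argument: a sequence in the hull minimising the \<open>L\<^sup>2\<close> norm is Cauchy by the
  parallelogram law, and its limit is invariant because translation preserves the norm.\<close>

lemma mean_ergodic:
  assumes M: "M \<in> extreme_measures (invariant_measures G T)" and f: "continuous_on UNIV f"
    and bounds: "\<And>x. 1/4 \<le> f x" "\<And>x. f x \<le> 3/4" and e: "e > 0"
  obtains u where "u \<in> translate_hull f" "(\<integral>x. \<bar>u x - (\<integral>x. f x \<partial>M)\<bar> \<partial>M) < e"
proof -
  have Mi: "M \<in> invariant_measures G T" using M by (simp add: extreme_measures_def)
  note MD = invariant_measuresD[OF Mi]
  interpret prob_space M by (rule MD)
  let ?H = "translate_hull f"
  define q where "q u = (\<integral>x. (u x)\<^sup>2 \<partial>M)" for u :: "'x \<Rightarrow> real"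
  define d where "d = (INF u\<in>?H. q u)"
  have Hc: "continuous_on UNIV u" and Hb: "1/4 \<le> u x" "u x \<le> 3/4" if "u \<in> ?H" for u x
    using translate_hull_continuous[OF that f] translate_hull_bounds[OF that bounds] by auto
  have bdd: "bdd_below (q ` ?H)" by (intro bdd_belowI[of _ 0]) (auto simp: q_def)
  have d_le: "d \<le> q u" if "u \<in> ?H" for u unfolding d_def using bdd that by (rule cINF_lower)
  have int: "integrable M h" if "continuous_on UNIV h" for h :: "'x \<Rightarrow> real"
    using integrable_cont[OF Mi that] .
  have para: "(\<integral>x. (u x - v x)\<^sup>2 \<partial>M) \<le> 2 * (q u - d) + 2 * (q v - d)" if "u \<in> ?H" "v \<in> ?H" for u v
  proof -
    note c = Hc[OF that(1)] Hc[OF that(2)]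
    have "(\<integral>x. (u x - v x)\<^sup>2 \<partial>M) = (\<integral>x. 2 * (u x)\<^sup>2 + 2 * (v x)\<^sup>2 - 4 * ((u x + v x) / 2)\<^sup>2 \<partial>M)"
      by (intro Bochner_Integration.integral_cong) (auto simp: power2_eq_square field_simps)
    also have "\<dots> = 2 * q u + 2 * q v - 4 * q (\<lambda>x. (u x + v x) / 2)"
    proof -
      have "integrable M (\<lambda>x. (u x)\<^sup>2)" "integrable M (\<lambda>x. (v x)\<^sup>2)" "integrable M (\<lambda>x. ((u x + v x) / 2)\<^sup>2)"
        by (intro int continuous_intros c; simp)+
      then show ?thesis unfolding q_def by (simp del: power_divide)
    qed
    finally show ?thesis using d_le[OF translate_hull.midpoint[OF that]] by simp
  qed
  have L1: "(\<integral>x. \<bar>u x - v x\<bar> \<partial>M)\<^sup>2 \<le> 2 * (q u - d) + 2 * (q v - d)" if "u \<in> ?H" "v \<in> ?H" for u v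
  proof -
    note c = Hc[OF that(1)] Hc[OF that(2)]
    have "integrable M (\<lambda>x. u x - v x)" "integrable M (\<lambda>x. (u x - v x)\<^sup>2)"
      by (intro int continuous_intros c)+
    then show ?thesis using square_integral_abs_le[of "\<lambda>x. u x - v x"] para[OF that] by linarith
  qed
  have "\<exists>u\<in>?H. q u < d + 1 / Suc n" for n
    using cINF_less_iff[OF _ bdd, of "d + 1 / Suc n"] translate_hull.base[of f] by (force simp: d_def[symmetric])
  then obtain s where s: "s n \<in> ?H" "q (s n) < d + 1 / Suc n" for n by metis
  have cauchy: "\<exists>N. \<forall>i\<ge>N. \<forall>j\<ge>N. (\<integral>x. norm (s i x - s j x) \<partial>M) < e" if "e > 0" for e :: real
  proof -
    \<comment> \<open>\<open>L1\<close> bounds the squared distance by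
      \<open>2 / Suc i + 2 / Suc j\<close>, which is at most \<open>4 / N\<close> for indices from
      \<open>N\<close> on.\<close>
    obtain N :: nat where N: "4 / e\<^sup>2 < N" using reals_Archimedean2 by blast
    then have "N > 0" using that by (intro Nat.gr0I) (auto simp: field_simps)
    have "(\<integral>x. norm (s i x - s j x) \<partial>M) < e" if "i \<ge> N" "j \<ge> N" for i j
    proof -
      have "1 / Suc i \<le> 1 / N" "1 / Suc j \<le> 1 / N" using that \<open>N > 0\<close> by (auto intro!: divide_left_mono)
      moreover have "4 * (1 / N) < e\<^sup>2" using N \<open>N > 0\<close> \<open>e > 0\<close> by (simp add: field_simps)
      ultimately have "(\<integral>x. \<bar>s i x - s j x\<bar> \<partial>M)\<^sup>2 < e\<^sup>2"
        using L1[OF s(1) s(1), of i j] s(2)[of i] s(2)[of j] by argo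
      then show ?thesis using \<open>e > 0\<close> by (simp add: power_less_imp_less_base)
    qed
    then show ?thesis by blast
  qed
  obtain r where r: "strict_mono r" "AE x in M. Cauchy (\<lambda>i. s (r i) x)"
    using cauchy_L1_AE_cauchy_subseq[of M s, OF int[OF Hc[OF s(1)]] cauchy] by blast
  \<comment> \<open>Clamping gives the bounds everywhere, also on the null set where the subsequence
    may diverge. Where it converges nothing changes, since the hull obeys the same bounds.\<close>
  define w where "w x = max (1/4) (min (3/4) (lim (\<lambda>i. s (r i) x)))" for x
  have s_meas[measurable]: "s i \<in> borel_measurable borel" for i
    using borel_measurable_continuous_onI[OF Hc[OF s(1)]] .
  have w_meas[measurable]: "w \<in> borel_measurable borel" unfolding w_def by measurable
  have toM: "h \<in> borel_measurable M" if "h \<in> borel_measurable borel" for h :: "'x \<Rightarrow> real"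
    using that MD(3) by (simp cong: measurable_cong_sets)
  have lim: "AE x in M. (\<lambda>i. s (r i) x) \<longlonglongrightarrow> w x"
    using r(2)
  proof eventually_elim
    case (elim x)
    then have L: "(\<lambda>i. s (r i) x) \<longlonglongrightarrow> lim (\<lambda>i. s (r i) x)"
      by (simp add: Cauchy_convergent convergent_LIMSEQ_iff[symmetric])
    moreover have "1/4 \<le> lim (\<lambda>i. s (r i) x)" "lim (\<lambda>i. s (r i) x) \<le> 3/4"
      using LIMSEQ_le_const[OF L] LIMSEQ_le_const2[OF L] Hb[OF s(1)] by blast+
    ultimately show ?case by (simp add: w_def)
  qed
  have wb: "1/4 \<le> w x" "w x \<le> 3/4" for x by (auto simp: w_def)
  have dom: "(\<lambda>i. \<integral>x. h x * s (r i) x \<partial>M) \<longlonglongrightarrow> (\<integral>x. h x * w x \<partial>M)"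
    if "h \<in> borel_measurable borel" "\<And>x. \<bar>h x\<bar> \<le> 1" for h
  proof (rule integral_dominated_convergence[where w = "\<lambda>_. 1"])
    show "AE x in M. (\<lambda>i. h x * s (r i) x) \<longlonglongrightarrow> h x * w x"
      using lim by eventually_elim (rule tendsto_mult_left)
    show "AE x in M. norm (h x * s (r i) x) \<le> 1" for i
    proof (rule AE_I2)
      fix x
      have "\<bar>s (r i) x\<bar> \<le> 1" using Hb[OF s(1), of "r i" x] by auto
      then show "norm (h x * s (r i) x) \<le> 1" using that(2)[of x] by (simp add: abs_mult mult_le_one)
    qed
  qed (use that in \<open>auto intro!: toM\<close>)
  have inv: "(\<integral>x. indicator (T g -` A) x * w x \<partial>M) = (\<integral>x. indicator A x * w x \<partial>M)"
    if g: "g \<in> carrier G" and A: "A \<in> sets borel" for g A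
  proof -
    have A': "T g -` A \<in> sets borel" using measurable_sets[OF measurable_T[OF g] A] by simp
    let ?D = "\<lambda>i. (\<integral>x. indicator (T g -` A) x * s (r i) x \<partial>M) - (\<integral>x. indicator A x * s (r i) x \<partial>M)"
    \<comment> \<open>Invariance of \<open>M\<close> rewrites the difference as an integral of
      \<open>?u - ?v\<close> over the preimage of A. The translate \<open>?v\<close> lies in the
      hull and has the same norm as \<open>?u\<close>, so both are within
      \<open>1 / Suc (r i)\<close> of the infimum; \<open>L1\<close> then gives
      \<open>4 / Suc (r i)\<close>, and \<open>r i \<ge> i\<close>.\<close>
    have bound: "\<bar>?D i\<bar> \<le> sqrt (4 / Suc i)" for i
    proof -
      let ?u = "s (r i)"
      let ?v = "\<lambda>x. ?u (T g x)"
      have v: "?v \<in> ?H" using s(1) g by (rule translate_hull.translate)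
      have qv: "q ?v = q ?u"
        unfolding q_def using integral_comp_T[OF Mi g, of "\<lambda>x. (?u x)\<^sup>2"] by simp
      have "(\<integral>x. indicator A x * ?u x \<partial>M) = (\<integral>x. indicator A (T g x) * ?v x \<partial>M)"
        using integral_comp_T[OF Mi g, of "\<lambda>x. indicator A x * ?u x"] A by simp
      also have "\<dots> = (\<integral>x. indicator (T g -` A) x * ?v x \<partial>M)"
        by (intro Bochner_Integration.integral_cong) (auto simp: indicator_def)
      finally have "?D i = (\<integral>x. indicator (T g -` A) x * ?u x \<partial>M) - (\<integral>x. indicator (T g -` A) x * ?v x \<partial>M)"
        by simp
      also have "\<dots> = (\<integral>x. indicator (T g -` A) x * (?u x - ?v x) \<partial>M)"
      proof -
        have "integrable M (\<lambda>x. indicator (T g -` A) x * h x)" if "h \<in> ?H" for h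
          using A' MD(3) int[OF Hc[OF that]] by (simp add: integrable_real_mult_indicator mult.commute)
        then show ?thesis using s(1) v by (simp add: right_diff_distrib)
      qed
      also have "\<bar>\<dots>\<bar> \<le> (\<integral>x. \<bar>?u x - ?v x\<bar> \<partial>M)"
      proof -
        have "integrable M (\<lambda>x. \<bar>?u x - ?v x\<bar>)"
          using Hc[OF s(1)] Hc[OF v] by (intro int continuous_intros)
        then have "(\<integral>x. \<bar>indicator (T g -` A) x * (?u x - ?v x)\<bar> \<partial>M) \<le> (\<integral>x. \<bar>?u x - ?v x\<bar> \<partial>M)"
          by (intro integral_mono') (auto simp: indicator_def)
        then show ?thesis using integral_abs_bound[of M "\<lambda>x. indicator (T g -` A) x * (?u x - ?v x)"] by linarith
      qed
      finally have "\<bar>?D i\<bar> \<le> (\<integral>x. \<bar>?u x - ?v x\<bar> \<partial>M)" .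
      moreover have "(\<integral>x. \<bar>?u x - ?v x\<bar> \<partial>M)\<^sup>2 \<le> 4 / Suc i"
      proof -
        have "1 / Suc (r i) \<le> 1 / Suc i"
          using seq_suble[OF r(1), of i] by (intro divide_left_mono) auto
        then show ?thesis using L1[OF s(1) v, of "r i"] s(2)[of "r i"] qv by simp
      qed
      ultimately show ?thesis by (meson order_trans real_le_rsqrt)
    qed
    have "(\<lambda>i. sqrt (4 / Suc i)) \<longlonglongrightarrow> 0" by real_asymp
    then have "?D \<longlonglongrightarrow> 0"
      by (rule Lim_null_comparison[rotated]) (use bound in auto)
    moreover have "?D \<longlonglongrightarrow> (\<integral>x. indicator (T g -` A) x * w x \<partial>M) - (\<integral>x. indicator A x * w x \<partial>M)"
      using A A' by (intro tendsto_diff dom borel_measurable_indicator) (auto simp: indicator_def)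
    ultimately show ?thesis using LIMSEQ_unique by fastforce
  qed
  have "(\<lambda>i. \<integral>x. s (r i) x \<partial>M) \<longlonglongrightarrow> (\<integral>x. w x \<partial>M)"
    using dom[of "\<lambda>_. 1"] by simp
  then have w_int: "(\<integral>x. w x \<partial>M) = (\<integral>x. f x \<partial>M)"
    using translate_hull_integral[OF s(1) f Mi] by (simp add: LIMSEQ_const_iff)
  have const: "(\<integral>x. \<bar>w x - (\<integral>x. f x \<partial>M)\<bar> \<partial>M) = 0"
    using invariant_density_const[of M w, OF M w_meas wb inv] unfolding w_int .
  have int_w: "integrable M w"
  proof (rule integrable_const_bound[where B = 1])
    have "\<bar>w x\<bar> \<le> 1" for x using wb[of x] by auto
    then show "AE x in M. norm (w x) \<le> 1" by auto
  qed (rule toM[OF w_meas])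
  have "(\<lambda>i. \<integral>x. \<bar>s (r i) x - w x\<bar> \<partial>M) \<longlonglongrightarrow> (\<integral>x. 0 \<partial>M)"
  proof (rule integral_dominated_convergence[where w = "\<lambda>_. 1"])
    show "AE x in M. (\<lambda>i. \<bar>s (r i) x - w x\<bar>) \<longlonglongrightarrow> 0"
      using lim
    proof eventually_elim
      case (elim x)
      then show ?case using tendsto_rabs[OF tendsto_diff[OF elim tendsto_const[of "w x"]]] by simp
    qed
    show "AE x in M. norm \<bar>s (r i) x - w x\<bar> \<le> 1" for i
    proof (rule AE_I2)
      fix x
      show "norm \<bar>s (r i) x - w x\<bar> \<le> 1" using Hb[OF s(1), of "r i" x] wb[of x] by auto
    qed
  qed (auto intro!: toM)
  then have "\<forall>\<^sub>F i in sequentially. (\<integral>x. \<bar>s (r i) x - w x\<bar> \<partial>M) < e"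
    using e by (intro order_tendstoD) auto
  then obtain i where i: "(\<integral>x. \<bar>s (r i) x - w x\<bar> \<partial>M) < e"
    using eventually_happens by fastforce
  have "(\<integral>x. \<bar>s (r i) x - (\<integral>x. f x \<partial>M)\<bar> \<partial>M) \<le> (\<integral>x. \<bar>s (r i) x - w x\<bar> + \<bar>w x - (\<integral>x. f x \<partial>M)\<bar> \<partial>M)"
    using int_w int[OF Hc[OF s(1)]] by (intro integral_mono) auto
  also have "\<dots> = (\<integral>x. \<bar>s (r i) x - w x\<bar> \<partial>M) + (\<integral>x. \<bar>w x - (\<integral>x. f x \<partial>M)\<bar> \<partial>M)"
    using int_w int[OF Hc[OF s(1)]] by (intro Bochner_Integration.integral_add) auto
  finally show ?thesis using i const that[OF s(1), of "r i"] by linarith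
qed

end

section \<open>Pointwise convergence and generic points\<close>

context tempered_action
begin

text \<open>If \<open>avg k f x\<close> is further than 2e from the mean a for arbitrarily large k,
  pick a member u of the hull: its averages are eventually within e of those of \<open>f\<close>, so
  the average of \<open>\<bar>u - a\<bar>\<close> at x exceeds e for some k. The maximal inequality
  bounds the measure of such points by a multiple of \<delta> / e, where \<delta> bounds the L1
  distance of u from a. The bad set does not depend on u, so \<delta> can tend to 0.\<close>

lemma pointwise_ergodic_bounded:
  assumes M: "M \<in> extreme_measures (invariant_measures G T)" and f: "continuous_on UNIV f"
    and bounds: "\<And>x. 1/4 \<le> f x" "\<And>x. f x \<le> 3/4"
  shows "AE x in M. (\<lambda>k. avg k f x) \<longlonglongrightarrow> (\<integral>x. f x \<partial>M)"
proof -
  have Mi: "M \<in> invariant_measures G T" using M by (simp add: extreme_measures_def)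
  note MD = invariant_measuresD[OF Mi]
  interpret prob_space M by (rule MD)
  define a where "a = (\<integral>x. f x \<partial>M)"
  have [measurable]: "avg k u \<in> borel_measurable M" if "continuous_on UNIV u" for k u
    using borel_measurable_continuous_onI[OF continuous_avg[OF that], of k] MD(3) by (simp cong: measurable_cong_sets)
  note f[measurable]
  have ev: "AE x in M. \<forall>\<^sub>F k in sequentially. \<bar>avg k f x - a\<bar> \<le> 2 * e" if e: "e > 0" for e
  proof -
    define E where "E = {x \<in> space M. \<not> (\<forall>\<^sub>F k in sequentially. \<bar>avg k f x - a\<bar> \<le> 2 * e)}"
    have E: "E \<in> sets M" unfolding E_def by measurable
    have small: "e * measure M E \<le> 2 * (1 + c) * \<delta>" if \<delta>: "\<delta> > 0" for \<delta>
    proof -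
      obtain u where u: "u \<in> translate_hull f" "(\<integral>x. \<bar>u x - a\<bar> \<partial>M) < \<delta>"
        using mean_ergodic[OF M f bounds \<delta>] by (auto simp: a_def)
      have uc: "continuous_on UNIV u" using translate_hull_continuous[OF u(1) f] .
      then have uac: "continuous_on UNIV (\<lambda>x. \<bar>u x - a\<bar>)" by (intro continuous_intros)
      have "E \<subseteq> {x. \<exists>k. e < avg k (\<lambda>x. \<bar>u x - a\<bar>) x}"
      proof
        fix x assume "x \<in> E"
        then have "\<exists>\<^sub>F k in sequentially. \<not> \<bar>avg k f x - a\<bar> \<le> 2 * e"
          by (simp add: E_def not_eventually)
        moreover have "\<forall>\<^sub>F k in sequentially. \<bar>avg k f x - avg k u x\<bar> < e"
          using translate_hull_avg[OF u(1) f e] by eventually_elim blast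
        ultimately have "\<exists>\<^sub>F k in sequentially. \<not> \<bar>avg k f x - a\<bar> \<le> 2 * e \<and> \<bar>avg k f x - avg k u x\<bar> < e"
          by (rule frequently_eventually_frequently)
        then obtain k where k: "\<not> \<bar>avg k f x - a\<bar> \<le> 2 * e" "\<bar>avg k f x - avg k u x\<bar> < e"
          using frequently_ex by blast
        have "avg k u x - a = avg k (\<lambda>x. u x - a) x" by (simp add: avg_diff avg_const)
        then have "\<bar>avg k u x - a\<bar> \<le> avg k (\<lambda>x. \<bar>u x - a\<bar>) x" using abs_avg_le by simp
        then show "x \<in> {x. \<exists>k. e < avg k (\<lambda>x. \<bar>u x - a\<bar>) x}" using k by (auto intro!: exI[of _ k])
      qed
      moreover have "{x \<in> space M. \<exists>k. e < avg k (\<lambda>x. \<bar>u x - a\<bar>) x} \<in> sets M" using uac by measurable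
      ultimately have "measure M E \<le> measure M {x. \<exists>k. e < avg k (\<lambda>x. \<bar>u x - a\<bar>) x}"
        using MD(4) by (intro finite_measure_mono) auto
      then have "e * measure M E \<le> e * measure M {x. \<exists>k. e < avg k (\<lambda>x. \<bar>u x - a\<bar>) x}"
        using e by (intro mult_left_mono) auto
      also have "\<dots> \<le> 2 * (1 + c) * (\<integral>x. \<bar>u x - a\<bar> \<partial>M)"
        using e by (intro maximal_inequality Mi uac) auto
      also have "\<dots> \<le> 2 * (1 + c) * \<delta>" using u(2) c_pos by (intro mult_left_mono) auto
      finally show ?thesis .
    qed
    have "e * measure M E \<le> 0"
    proof (rule field_le_epsilon)
      fix y :: real assume "y > 0"
      then have "2 * (1 + c) * (y / (2 * (1 + c))) = y" "y / (2 * (1 + c)) > 0" using c_pos by auto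
      then show "e * measure M E \<le> 0 + y" using small[of "y / (2 * (1 + c))"] by simp
    qed
    then have "emeasure M E = 0" using e by (simp add: emeasure_eq_measure mult_le_0_iff measure_le_0_iff)
    then have "E \<in> null_sets M" using E by auto
    then show ?thesis by (rule AE_I') (auto simp: E_def)
  qed
  have "AE x in M. \<forall>n. \<forall>\<^sub>F k in sequentially. \<bar>avg k f x - a\<bar> \<le> 2 * (1 / Suc n)"
    unfolding AE_all_countable by (intro allI ev) simp
  then show ?thesis
  proof eventually_elim
    case (elim x)
    show ?case
    proof (rule tendstoI)
      fix e :: real assume "e > 0"
      then obtain n where n: "1 / Suc n < e / 2" using reals_Archimedean[of "e / 2"] by (auto simp: field_simps)
      show "\<forall>\<^sub>F k in sequentially. dist (avg k f x) (\<integral>x. f x \<partial>M) < e"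
        using elim[rule_format, of n] by (rule eventually_mono) (use n in \<open>auto simp: dist_real_def a_def\<close>)
    qed
  qed
qed

lemma pointwise_ergodic:
  fixes f :: "'x \<Rightarrow> real"
  assumes M: "M \<in> extreme_measures (invariant_measures G T)" and f: "continuous_on UNIV f"
  shows "AE x in M. (\<lambda>k. avg k f x) \<longlonglongrightarrow> (\<integral>x. f x \<partial>M)"
proof -
  have Mi: "M \<in> invariant_measures G T" using M by (simp add: extreme_measures_def)
  interpret prob_space M by (rule invariant_measuresD[OF Mi])
  obtain B where B: "B > 0" "\<And>x. \<bar>f x\<bar> \<le> B" using continuous_on_UNIV_abs_bounded[OF compact_space f] by blast
  \<comment> \<open>An affine change carries [-B, B] onto [1/4, 3/4]; averages and integrals commute
    with it.\<close>
  define h where "h x = 1/2 + 1 / (4 * B) * f x" for x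
  have hc: "continuous_on UNIV h" unfolding h_def using f by (intro continuous_intros)
  have fh: "f x = 4 * B * h x - 2 * B" for x using B(1) by (simp add: h_def field_simps)
  have "1/4 \<le> h x" "h x \<le> 3/4" for x
    using B(2)[of x] B(1) by (auto simp: h_def field_simps abs_le_iff)
  from pointwise_ergodic_bounded[OF M hc this] show ?thesis
  proof eventually_elim
    case (elim x)
    have "avg k f x = 4 * B * avg k h x - 2 * B" for k
      unfolding fh[abs_def] by (simp add: avg_diff avg_cmult avg_const)
    moreover have "(\<integral>x. f x \<partial>M) = 4 * B * (\<integral>x. h x \<partial>M) - 2 * B"
      using integrable_cont[OF Mi hc] by (simp add: fh prob_space)
    ultimately show ?case using elim by (auto intro!: tendsto_intros)
  qed
qed

end

text \<open>Separability of C(X) in explicit form: for every m a finite net of mesh 1 / (m + 1)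
  carries a partition of unity, and uniform continuity makes \<open>f\<close> close to the
  combination whose coefficients are its values at the net points.\<close>

lemma countable_test_functions:
  assumes "compact (UNIV :: 'a::metric_space set)"
  obtains J :: "(nat \<times> 'a::metric_space) set" and \<psi> :: "nat \<times> 'a::metric_space \<Rightarrow> 'a \<Rightarrow> real"
  where "countable J" "\<forall>j\<in>J. continuous_on UNIV (\<psi> j)"
    "\<forall>(f :: 'a::metric_space \<Rightarrow> real) e. continuous_on UNIV f \<longrightarrow> e > 0 \<longrightarrow>
      (\<exists>I a. finite I \<and> I \<subseteq> J \<and> (\<forall>x. \<bar>f x - (\<Sum>j\<in>I. a j * \<psi> j x)\<bar> < e))"
proof -
  have "\<exists>C :: 'a set. finite C \<and> UNIV \<subseteq> (\<Union>x\<in>C. ball x (1 / Suc m))" for m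
    using assms unfolding compact_eq_totally_bounded by simp
  then obtain C :: "nat \<Rightarrow> 'a set" where C: "finite (C m)" "UNIV \<subseteq> (\<Union>x\<in>C m. ball x (1 / Suc m))" for m
    by metis
  have near: "\<exists>p\<in>C m. dist p x < 1 / Suc m" for m x
  proof -
    have "x \<in> (\<Union>p\<in>C m. ball p (1 / Suc m))" using C(2) by blast
    then show ?thesis by auto
  qed
  define \<phi> where "\<phi> m p x = max 0 (1 / Suc m - dist p x)" for m p and x :: 'a
  \<comment> \<open>The tent functions are divided by their sum, which is positive because the balls
    around the net points cover the space.\<close>
  define \<psi> where "\<psi> = (\<lambda>(m, p) x. \<phi> m p x / (\<Sum>q\<in>C m. \<phi> m q x))"
  have nonneg: "0 \<le> \<phi> m p x" for m p x by (simp add: \<phi>_def)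
  have pos: "0 < (\<Sum>q\<in>C m. \<phi> m q x)" for m x
  proof -
    obtain p where "p \<in> C m" "dist p x < 1 / Suc m" using near by blast
    then show ?thesis using nonneg C(1) by (intro sum_pos2[of _ p]) (auto simp: \<phi>_def)
  qed
  show ?thesis
  proof (rule that[of "Sigma UNIV C" \<psi>]; (intro ballI allI impI)?)
    show "countable (Sigma UNIV C)" using C(1) by (intro countable_SIGMA) (auto intro: countable_finite)
    fix j :: "nat \<times> 'a"
    obtain m p where j: "j = (m, p)" by (cases j)
    have "continuous_on UNIV (\<phi> m q)" for q unfolding \<phi>_def by (intro continuous_intros)
    then show "continuous_on UNIV (\<psi> j)"
      using pos[of m] unfolding j \<psi>_def prod.case
      by (intro continuous_on_divide continuous_on_sum) (auto simp: less_le)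
  next
    fix f :: "'a \<Rightarrow> real" and e :: real
    assume f: "continuous_on UNIV f" and e: "e > 0"
    have "uniformly_continuous_on UNIV f" using compact_uniformly_continuous[OF f assms] .
    then obtain d where d: "d > 0" "\<And>x y. dist x y < d \<Longrightarrow> \<bar>f x - f y\<bar> < e"
      using e unfolding uniformly_continuous_on_def dist_real_def by (metis UNIV_I)
    obtain m where m: "1 / Suc m < d" using reals_Archimedean[OF d(1)] by (auto simp: field_simps)
    have "\<bar>f x - (\<Sum>j\<in>Pair m ` C m. f (snd j) * \<psi> j x)\<bar> < e" for x
    proof -
      let ?S = "\<Sum>q\<in>C m. \<phi> m q x"
      have "(\<Sum>j\<in>Pair m ` C m. f (snd j) * \<psi> j x) = (\<Sum>p\<in>C m. f p * \<phi> m p x) / ?S"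
        by (simp add: sum.reindex inj_on_def \<psi>_def sum_divide_distrib)
      then have "f x - (\<Sum>j\<in>Pair m ` C m. f (snd j) * \<psi> j x) = (f x * ?S - (\<Sum>p\<in>C m. f p * \<phi> m p x)) / ?S"
        using pos[of m x] by (simp add: diff_divide_distrib)
      also have "\<dots> = (\<Sum>p\<in>C m. (f x - f p) * \<phi> m p x) / ?S"
        by (simp add: sum_subtractf left_diff_distrib sum_distrib_left)
      also have "\<bar>\<dots>\<bar> = \<bar>\<Sum>p\<in>C m. (f x - f p) * \<phi> m p x\<bar> / ?S" using pos[of m x] by simp
      also have "\<bar>\<Sum>p\<in>C m. (f x - f p) * \<phi> m p x\<bar> \<le> (\<Sum>p\<in>C m. \<bar>f x - f p\<bar> * \<phi> m p x)"
        using sum_abs[of "\<lambda>p. (f x - f p) * \<phi> m p x" "C m"] nonneg by (simp add: abs_mult)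
      also have "\<dots> < (\<Sum>p\<in>C m. e * \<phi> m p x)"
      proof (rule sum_strict_mono_ex1)
        show le: "\<forall>p\<in>C m. \<bar>f x - f p\<bar> * \<phi> m p x \<le> e * \<phi> m p x"
        proof
          fix p
          have "\<bar>f x - f p\<bar> \<le> e" if "\<phi> m p x \<noteq> 0"
            using that d(2)[of x p] m by (auto simp: \<phi>_def dist_commute max_def split: if_splits)
          then show "\<bar>f x - f p\<bar> * \<phi> m p x \<le> e * \<phi> m p x"
            using nonneg[of m p x] by (cases "\<phi> m p x = 0") (auto intro: mult_right_mono)
        qed
        obtain p where p: "p \<in> C m" "dist p x < 1 / Suc m" using near by blast
        then have "\<bar>f x - f p\<bar> < e" "\<phi> m p x > 0" using d(2)[of x p] m by (auto simp: \<phi>_def dist_commute)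
        then show "\<exists>p\<in>C m. \<bar>f x - f p\<bar> * \<phi> m p x < e * \<phi> m p x"
          using p(1) by (blast intro: mult_strict_right_mono)
      qed (rule C)
      finally show ?thesis using pos[of m x] by (simp add: sum_distrib_left[symmetric] divide_simps split: if_splits)
    qed
    then show "\<exists>I a. finite I \<and> I \<subseteq> Sigma UNIV C \<and> (\<forall>x. \<bar>f x - (\<Sum>j\<in>I. a j * \<psi> j x)\<bar> < e)"
      using C(1) by (intro exI[of _ "Pair m ` C m"] exI[of _ "\<lambda>j. f (snd j)"]) auto
  qed
qed

section \<open>Generic points\<close>

context tempered_action
begin

definition generic :: "'x measure \<Rightarrow> 'x \<Rightarrow> bool" where
  "generic M x \<longleftrightarrow> (\<forall>f. continuous_on UNIV f \<longrightarrow> (\<lambda>k. avg k f x) \<longlonglongrightarrow> (\<integral>x. f x \<partial>M))"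

text \<open>The null set of the pointwise theorem depends on the function; a countable family with
  dense span leaves a single null set. Averages and integrals do not increase the sup norm, so the
  approximation costs e / 3 on each side.\<close>

lemma AE_generic:
  assumes M: "M \<in> extreme_measures (invariant_measures G T)"
  shows "AE x in M. generic M x"
proof -
  have Mi: "M \<in> invariant_measures G T" using M by (simp add: extreme_measures_def)
  interpret prob_space M by (rule invariant_measuresD[OF Mi])
  obtain J :: "(nat \<times> 'x) set" and \<psi> where J: "countable J" "\<forall>j\<in>J. continuous_on UNIV (\<psi> j)"
    "\<forall>(f :: 'x \<Rightarrow> real) e. continuous_on UNIV f \<longrightarrow> e > 0 \<longrightarrow>
      (\<exists>I a. finite I \<and> I \<subseteq> J \<and> (\<forall>x. \<bar>f x - (\<Sum>j\<in>I. a j * \<psi> j x)\<bar> < e))"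
    using countable_test_functions[OF compact_space] by blast
  have "AE x in M. \<forall>j\<in>J. (\<lambda>k. avg k (\<psi> j) x) \<longlonglongrightarrow> (\<integral>x. \<psi> j x \<partial>M)"
    unfolding AE_ball_countable[OF J(1)] using pointwise_ergodic[OF M] J(2) by blast
  then show ?thesis
  proof eventually_elim
    case (elim x)
    show ?case
      unfolding generic_def
    proof (intro allI impI tendstoI)
      fix f :: "'x \<Rightarrow> real" and e :: real
      assume f: "continuous_on UNIV f" and e: "e > 0"
      then obtain I a where I: "finite I" "I \<subseteq> J" "\<And>x. \<bar>f x - (\<Sum>j\<in>I. a j * \<psi> j x)\<bar> < e / 3"
        using J(3)[rule_format, of f "e / 3"] by auto
      let ?s = "\<lambda>x. \<Sum>j\<in>I. a j * \<psi> j x"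
      have s: "continuous_on UNIV ?s" using I J(2) by (intro continuous_intros) auto
      have avg_s: "avg k ?s x = (\<Sum>j\<in>I. a j * avg k (\<psi> j) x)" for k
        using avg_sum[of k "\<lambda>j x. a j * \<psi> j x" I x] by (simp add: avg_cmult)
      have int_s: "(\<integral>x. ?s x \<partial>M) = (\<Sum>j\<in>I. a j * (\<integral>x. \<psi> j x \<partial>M))"
        using I J(2) integrable_cont[OF Mi] by (subst Bochner_Integration.integral_sum) auto
      have "(\<lambda>k. avg k ?s x) \<longlonglongrightarrow> (\<integral>x. ?s x \<partial>M)"
        unfolding avg_s int_s using elim I by (intro tendsto_intros) auto
      then have "\<forall>\<^sub>F k in sequentially. dist (avg k ?s x) (\<integral>x. ?s x \<partial>M) < e / 3"
        using e by (intro tendstoD) auto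
      then show "\<forall>\<^sub>F k in sequentially. dist (avg k f x) (\<integral>x. f x \<partial>M) < e"
      proof eventually_elim
        case (elim k)
        have "\<bar>avg k f x - avg k ?s x\<bar> \<le> avg k (\<lambda>x. \<bar>f x - ?s x\<bar>) x"
          using abs_avg_le[of k "\<lambda>x. f x - ?s x" x] by (simp add: avg_diff)
        also have "\<dots> \<le> avg k (\<lambda>x. e / 3) x" using I(3) by (intro avg_mono less_imp_le)
        finally have 1: "\<bar>avg k f x - avg k ?s x\<bar> \<le> e / 3" by (simp add: avg_const)
        have "\<bar>(\<integral>x. f x \<partial>M) - (\<integral>x. ?s x \<partial>M)\<bar> = \<bar>\<integral>x. f x - ?s x \<partial>M\<bar>"
          using integrable_cont[OF Mi f] integrable_cont[OF Mi s] by simp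
        also have "\<dots> \<le> (\<integral>x. \<bar>f x - ?s x\<bar> \<partial>M)" by (rule integral_abs_bound)
        also have "\<dots> \<le> (\<integral>x. e / 3 \<partial>M)"
        proof (rule integral_mono)
          show "integrable M (\<lambda>x. \<bar>f x - ?s x\<bar>)"
            using integrable_cont[OF Mi f] integrable_cont[OF Mi s]
            by (intro integrable_abs Bochner_Integration.integrable_diff)
        qed (use I(3) in \<open>auto intro: less_imp_le\<close>)
        finally have 2: "\<bar>(\<integral>x. f x \<partial>M) - (\<integral>x. ?s x \<partial>M)\<bar> \<le> e / 3" by (simp add: prob_space)
        show ?case using elim 1 2 unfolding dist_real_def by linarith
      qed
    qed
  qed
qed

end

section \<open>Averages and balls of prescribed measure\<close>

text \<open>Convex combinations of measures are given setwise, and this passes to integrals. It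
  serves three mixtures: members of the hull, pushforwards under the elements of \<open>F k\<close>,
  and conditional measures on disjoint balls.\<close>

lemma integral_mixture:
  fixes f :: "'a::topological_space \<Rightarrow> real" and N :: "'i \<Rightarrow> 'a measure"
  assumes I: "finite I" and M: "M \<in> borel_probs" and N: "\<And>i. i \<in> I \<Longrightarrow> N i \<in> borel_probs"
    and mix: "\<And>A. A \<in> sets borel \<Longrightarrow> measure M A = (\<Sum>i\<in>I. w i * measure (N i) A)"
    and f[measurable]: "f \<in> borel_measurable borel" and B: "\<And>x. \<bar>f x\<bar> \<le> B"
  shows "(\<integral>x. f x \<partial>M) = (\<Sum>i\<in>I. w i * (\<integral>x. f x \<partial>N i))"
proof -
  \<comment> \<open>Rounding down to multiples of \<open>1 / Suc n\<close> is uniformly close to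
    \<open>f\<close> and takes finitely many values, since \<open>f\<close> is bounded; its integral
    is a finite combination of measures of level sets.\<close>
  define \<phi> where "\<phi> n x = real_of_int \<lfloor>real (Suc n) * f x\<rfloor> / Suc n" for n x
  define J where "J n = {\<lfloor>real (Suc n) * (- B)\<rfloor> .. \<lfloor>real (Suc n) * B\<rfloor>}" for n
  define L where "L n j = {x. \<lfloor>real (Suc n) * f x\<rfloor> = j}" for n j
  have L: "L n j \<in> sets borel" for n j unfolding L_def by measurable
  have \<phi>_near: "\<bar>\<phi> n x - f x\<bar> \<le> 1 / Suc n" for n x
  proof -
    have "\<bar>real_of_int \<lfloor>real (Suc n) * f x\<rfloor> - real (Suc n) * f x\<bar> \<le> 1" by linarith
    moreover have "\<phi> n x - f x = (real_of_int \<lfloor>real (Suc n) * f x\<rfloor> - real (Suc n) * f x) / Suc n"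
      by (simp add: \<phi>_def diff_divide_distrib)
    ultimately show ?thesis by (simp add: abs_divide divide_right_mono)
  qed
  have simple: "(\<integral>x. \<phi> n x \<partial>K) = (\<Sum>j\<in>J n. j / Suc n * measure K (L n j))" if K: "K \<in> borel_probs" for n K
  proof -
    interpret prob_space K by (rule borel_probsD[OF K])
    have "\<phi> n x = (\<Sum>j\<in>J n. j / Suc n * indicator (L n j) x)" for x
    proof -
      have "- B \<le> f x" "f x \<le> B" using B[of x] by auto
      then have "\<lfloor>real (Suc n) * f x\<rfloor> \<in> J n"
        unfolding J_def atLeastAtMost_iff by (intro conjI floor_mono mult_left_mono) simp_all
      then have "\<phi> n x = (\<Sum>j\<in>J n. if j = \<lfloor>real (Suc n) * f x\<rfloor> then j / Suc n else 0)"
        by (simp add: \<phi>_def J_def sum.delta)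
      also have "\<dots> = (\<Sum>j\<in>J n. j / Suc n * indicator (L n j) x)"
        by (intro sum.cong) (auto simp: L_def)
      finally show ?thesis .
    qed
    then show ?thesis
      using L borel_probsD[OF K] by (subst Bochner_Integration.integral_sum[symmetric] | simp add: emeasure_eq_measure)+
  qed
  have conv: "(\<lambda>n. \<integral>x. \<phi> n x \<partial>K) \<longlonglongrightarrow> (\<integral>x. f x \<partial>K)" if K: "K \<in> borel_probs" for K
  proof (rule integral_dominated_convergence[where w = "\<lambda>_. B + 1"])
    interpret prob_space K by (rule borel_probsD[OF K])
    show "integrable K (\<lambda>_. B + 1)" by simp
    show "f \<in> borel_measurable K" "\<phi> n \<in> borel_measurable K" for n
      unfolding \<phi>_def using borel_probsD(2)[OF K] by (simp_all cong: measurable_cong_sets)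
    show "AE x in K. (\<lambda>n. \<phi> n x) \<longlonglongrightarrow> f x"
    proof (rule AE_I2)
      fix x
      have "(\<lambda>n. 1 / real (Suc n)) \<longlonglongrightarrow> 0" by (rule LIMSEQ_Suc) (rule lim_const_over_n)
      then have "(\<lambda>n. \<phi> n x - f x) \<longlonglongrightarrow> 0"
        by (rule Lim_null_comparison[rotated]) (use \<phi>_near in auto)
      then show "(\<lambda>n. \<phi> n x) \<longlonglongrightarrow> f x" by (simp add: LIM_zero_iff)
    qed
    show "AE x in K. norm (\<phi> n x) \<le> B + 1" for n
    proof (rule AE_I2)
      fix x
      have "1 / real (Suc n) \<le> 1" by simp
      then show "norm (\<phi> n x) \<le> B + 1" using \<phi>_near[of n x] B[of x] unfolding real_norm_def by linarith
    qed
  qed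
  have "(\<integral>x. \<phi> n x \<partial>M) = (\<Sum>i\<in>I. w i * (\<integral>x. \<phi> n x \<partial>N i))" for n
  proof -
    have "(\<integral>x. \<phi> n x \<partial>M) = (\<Sum>j\<in>J n. \<Sum>i\<in>I. j / Suc n * (w i * measure (N i) (L n j)))"
      by (simp only: simple[OF M] mix[OF L] sum_distrib_left)
    also have "\<dots> = (\<Sum>i\<in>I. \<Sum>j\<in>J n. j / Suc n * (w i * measure (N i) (L n j)))" by (rule sum.swap)
    also have "\<dots> = (\<Sum>i\<in>I. w i * (\<integral>x. \<phi> n x \<partial>N i))"
      by (intro sum.cong refl) (simp add: simple[OF N] sum_distrib_left mult_ac)
    finally show ?thesis .
  qed
  moreover have "(\<lambda>n. \<Sum>i\<in>I. w i * (\<integral>x. \<phi> n x \<partial>N i)) \<longlonglongrightarrow> (\<Sum>i\<in>I. w i * (\<integral>x. f x \<partial>N i))"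
    by (intro tendsto_intros conv N)
  ultimately show ?thesis using conv[OF M] LIMSEQ_unique by auto
qed

section \<open>Conditional measures and balls of prescribed measure\<close>

lemma uniform_measure_borel_probs:
  assumes "\<mu> \<in> borel_probs" "A \<in> sets borel" "measure \<mu> A > 0"
  shows "uniform_measure \<mu> A \<in> borel_probs"
proof -
  interpret prob_space \<mu> by (rule borel_probsD[OF assms(1)])
  have "prob_space (uniform_measure \<mu> A)"
    using assms(3) by (intro prob_space_uniform_measure) (auto simp: emeasure_eq_measure)
  then show ?thesis using borel_probsD(2)[OF assms(1)] by (simp add: borel_probs_def)
qed

lemma integral_uniform_measure_near:
  fixes h :: "'a::topological_space \<Rightarrow> real"
  assumes \<mu>: "\<mu> \<in> borel_probs" and A: "A \<in> sets borel" "measure \<mu> A > 0"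
    and h: "h \<in> borel_measurable borel" "\<And>x. \<bar>h x\<bar> \<le> B" and near: "\<And>x. x \<in> A \<Longrightarrow> \<bar>h x - y\<bar> \<le> e"
  shows "\<bar>(\<integral>x. h x \<partial>uniform_measure \<mu> A) - y\<bar> \<le> e"
proof -
  note U = borel_probsD[OF uniform_measure_borel_probs[OF \<mu> A]]
  interpret prob_space "uniform_measure \<mu> A" by (rule U)
  have int: "integrable (uniform_measure \<mu> A) h"
    using h U(2) by (intro integrable_const_bound[where B = B]) (auto cong: measurable_cong_sets)
  have AE: "AE x in uniform_measure \<mu> A. \<bar>h x - y\<bar> \<le> e"
    using A near borel_probsD(2)[OF \<mu>] by (intro AE_uniform_measureI) auto
  have "\<bar>(\<integral>x. h x \<partial>uniform_measure \<mu> A) - y\<bar> = \<bar>\<integral>x. h x - y \<partial>uniform_measure \<mu> A\<bar>"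
    using int prob_space by simp
  also have "\<dots> \<le> (\<integral>x. \<bar>h x - y\<bar> \<partial>uniform_measure \<mu> A)" by (rule integral_abs_bound)
  also have "\<dots> \<le> (\<integral>x. e \<partial>uniform_measure \<mu> A)" using int AE by (intro integral_mono_AE) auto
  finally show ?thesis using prob_space by simp
qed

text \<open>The indicators of the balls converge at every point off the limiting sphere, and that
  sphere is null because \<open>\<mu>\<close> neglects shells.\<close>

lemma continuous_measure_ball:
  fixes \<mu> :: "'a::metric_space measure"
  assumes \<mu>: "\<mu> \<in> borel_probs" "neglects_shells \<mu>"
  shows "continuous_on {0..} (\<lambda>r. measure \<mu> (ball x r))"
  unfolding continuous_on_sequentially
proof (intro allI ballI impI)
  fix r :: "nat \<Rightarrow> real" and s
  assume s: "s \<in> {0..}" and r: "(\<forall>n. r n \<in> {0..}) \<and> r \<longlonglongrightarrow> s"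
  interpret prob_space \<mu> by (rule borel_probsD[OF \<mu>(1)])
  have balls[measurable]: "ball x t \<in> sets \<mu>" for t using borel_probsD(2)[OF \<mu>(1)] by simp
  have "closed {y. dist x y = s}" by (intro closed_Collect_eq continuous_intros)
  then have "{y. dist x y = s} \<in> null_sets \<mu>"
    using \<mu> s borel_probsD(2)[OF \<mu>(1)] by (auto simp: neglects_shells_def)
  then have AE: "AE y in \<mu>. dist x y \<noteq> s" by (rule AE_I') auto
  have "(\<lambda>n. \<integral>y. indicator (ball x (r n)) y \<partial>\<mu>) \<longlonglongrightarrow> (\<integral>y. indicator (ball x s) y \<partial>\<mu> :: real)"
  proof (rule integral_dominated_convergence[where w = "\<lambda>_. 1"])
    show "AE y in \<mu>. (\<lambda>n. indicator (ball x (r n)) y) \<longlonglongrightarrow> (indicator (ball x s) y :: real)"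
      using AE
    proof eventually_elim
      case (elim y)
      have "\<forall>\<^sub>F n in sequentially. (indicator (ball x (r n)) y :: real) = indicator (ball x s) y"
      proof (cases "dist x y < s")
        case True
        then have "\<forall>\<^sub>F n in sequentially. dist x y < r n" using r by (auto intro: order_tendstoD)
        then show ?thesis by eventually_elim (use True in simp)
      next
        case False
        then have "\<forall>\<^sub>F n in sequentially. r n < dist x y" using r elim by (auto intro: order_tendstoD)
        then show ?thesis by eventually_elim (use False in simp)
      qed
      then show ?case by (rule tendsto_eventually)
    qed
    show "indicat_real (ball x s) \<in> borel_measurable \<mu>" "indicat_real (ball x (r n)) \<in> borel_measurable \<mu>" for n
      by (rule borel_measurable_indicator[OF balls])+
  qed (auto simp: indicator_def)
  then show "((\<lambda>r. measure \<mu> (ball x r)) \<circ> r) \<longlonglongrightarrow> measure \<mu> (ball x s)"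
    using borel_probsD(3)[OF \<mu>(1)] by (simp add: o_def)
qed

text \<open>The intermediate value theorem, starting from the empty ball of radius 0.\<close>

lemma ball_of_measure:
  fixes \<mu> :: "'a::metric_space measure"
  assumes \<mu>: "\<mu> \<in> borel_probs" "neglects_shells \<mu>" and R: "R > 0" and v: "0 < v" "v \<le> measure \<mu> (ball p R)"
  obtains \<rho> where "0 < \<rho>" "\<rho> \<le> R" "measure \<mu> (ball p \<rho>) = v"
proof -
  have "\<exists>\<rho>\<ge>0. \<rho> \<le> R \<and> measure \<mu> (ball p \<rho>) = v"
    using v R by (intro IVT' continuous_on_subset[OF continuous_measure_ball[OF \<mu>]]) auto
  then obtain \<rho> where \<rho>: "0 \<le> \<rho>" "\<rho> \<le> R" "measure \<mu> (ball p \<rho>) = v" by blast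
  moreover have "\<rho> \<noteq> 0" using \<rho>(3) v(1) by auto
  ultimately show ?thesis by (intro that[of \<rho>]) auto
qed

lemma proportional_balls:
  fixes \<mu> :: "'a::metric_space measure"
  assumes \<mu>: "\<mu> \<in> borel_probs" "neglects_shells \<mu>" and P: "finite P" "P \<noteq> {}"
    and pos: "\<And>p r. p \<in> P \<Longrightarrow> r > 0 \<Longrightarrow> 0 < measure \<mu> (ball p r)"
    and R: "R > 0" and w: "\<And>p. p \<in> P \<Longrightarrow> 0 < w p"
  obtains m \<rho> where "m > 0" "\<And>p. p \<in> P \<Longrightarrow> 0 < \<rho> p" "\<And>p. p \<in> P \<Longrightarrow> \<rho> p \<le> R"
    "\<And>p. p \<in> P \<Longrightarrow> measure \<mu> (ball p (\<rho> p)) = m * w p"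
proof -
  \<comment> \<open>The largest factor for which every target \<open>m * w p\<close> still fits into
    the ball of radius \<open>R\<close>.\<close>
  define m where "m = Min ((\<lambda>p. measure \<mu> (ball p R) / w p) ` P)"
  have "m > 0" unfolding m_def using P pos R w by simp
  have "\<exists>\<rho>. 0 < \<rho> \<and> \<rho> \<le> R \<and> measure \<mu> (ball p \<rho>) = m * w p" if p: "p \<in> P" for p
  proof -
    have "m \<le> measure \<mu> (ball p R) / w p" unfolding m_def using P p by simp
    then have "m * w p \<le> measure \<mu> (ball p R)" using w[OF p] by (simp add: pos_le_divide_eq)
    moreover have "0 < m * w p" using \<open>m > 0\<close> w[OF p] by simp
    ultimately show ?thesis using ball_of_measure[OF \<mu> R] by metis
  qed
  then obtain \<rho> where "0 < \<rho> p \<and> \<rho> p \<le> R \<and> measure \<mu> (ball p (\<rho> p)) = m * w p" if "p \<in> P" for p by metis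
  then show ?thesis using that[OF \<open>m > 0\<close>] by blast
qed

section \<open>The averaged measures and their integrals\<close>

context tempered_action
begin

lemma distr_T_borel_probs:
  assumes "\<beta> \<in> borel_probs" "g \<in> carrier G"
  shows "distr \<beta> borel (T g) \<in> borel_probs"
proof -
  have "T g \<in> measurable \<beta> borel"
    using measurable_T[OF assms(2)] borel_probsD(2)[OF assms(1)] by (simp cong: measurable_cong_sets)
  then show ?thesis using borel_probsD(1)[OF assms(1)] by (simp add: borel_probs_def prob_space.prob_space_distr)
qed

text \<open>\<open>measure_of\<close> takes the prescribed values only after countable additivity is
  shown. It holds because each summand is a pushforward, and the pushforwards also prepare the use
  of \<open>integral_mixture\<close>.\<close>

lemma emeasure_avg_measure:
  assumes \<beta>: "\<beta> \<in> borel_probs" and A: "A \<in> sets borel"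
  shows "emeasure (avg_measure T (F k) \<beta>) A = (\<Sum>g\<in>F k. emeasure (distr \<beta> borel (T g)) A) / of_nat (card (F k))"
proof -
  have eq: "(\<Sum>g\<in>F k. emeasure \<beta> (T g -` A)) = (\<Sum>g\<in>F k. emeasure (distr \<beta> borel (T g)) A)"
    if "A \<in> sets borel" for A
    using that borel_probsD(2,3)[OF \<beta>] measurable_T[OF F_carrier]
    by (intro sum.cong) (auto simp: emeasure_distr cong: measurable_cong_sets)
  have "emeasure (avg_measure T (F k) \<beta>) A = (\<Sum>g\<in>F k. emeasure \<beta> (T g -` A)) / of_nat (card (F k))"
    unfolding avg_measure_def
  proof (rule emeasure_measure_of_sigma)
    show "sigma_algebra UNIV (sets (borel :: 'x measure))" using sets.sigma_algebra_axioms[of borel] by simp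
    show "positive (sets borel) (\<lambda>A. (\<Sum>g\<in>F k. emeasure \<beta> (T g -` A)) / of_nat (card (F k)))"
      by (simp add: positive_def)
    show "countably_additive (sets borel) (\<lambda>A. (\<Sum>g\<in>F k. emeasure \<beta> (T g -` A)) / of_nat (card (F k)))"
      unfolding countably_additive_def
    proof (intro allI impI)
      fix D :: "nat \<Rightarrow> 'x set"
      assume D: "range D \<subseteq> sets borel" "disjoint_family D" "\<Union> (range D) \<in> sets borel"
      have "(\<Sum>i. (\<Sum>g\<in>F k. emeasure \<beta> (T g -` D i)) / of_nat (card (F k)))
          = (\<Sum>i. \<Sum>g\<in>F k. emeasure (distr \<beta> borel (T g)) (D i)) / of_nat (card (F k))"
        using D by (simp add: eq range_subsetD)
      also have "(\<Sum>i. \<Sum>g\<in>F k. emeasure (distr \<beta> borel (T g)) (D i))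
          = (\<Sum>g\<in>F k. \<Sum>i. emeasure (distr \<beta> borel (T g)) (D i))"
        by (intro suminf_sum) simp
      also have "\<dots> = (\<Sum>g\<in>F k. emeasure (distr \<beta> borel (T g)) (\<Union> (range D)))"
        using D by (intro sum.cong suminf_emeasure) auto
      also have "\<dots> = (\<Sum>g\<in>F k. emeasure \<beta> (T g -` \<Union> (range D)))" using eq[OF D(3)] by simp
      finally show "(\<Sum>i. (\<Sum>g\<in>F k. emeasure \<beta> (T g -` D i)) / of_nat (card (F k)))
          = (\<Sum>g\<in>F k. emeasure \<beta> (T g -` \<Union> (range D))) / of_nat (card (F k))" .
    qed
  qed (rule A)
  then show ?thesis by (simp add: eq[OF A])
qed

lemma avg_measure_borel_probs:
  assumes \<beta>: "\<beta> \<in> borel_probs"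
  shows "avg_measure T (F k) \<beta> \<in> borel_probs"
    and "A \<in> sets borel \<Longrightarrow> measure (avg_measure T (F k) \<beta>) A = (\<Sum>g\<in>F k. 1 / card (F k) * measure (distr \<beta> borel (T g)) A)"
proof -
  have s: "sets (avg_measure T (F k) \<beta>) = sets borel" "space (avg_measure T (F k) \<beta>) = UNIV"
    using sets.sigma_sets_eq[of "borel :: 'x measure"] by (simp_all add: avg_measure_def)
  note N = borel_probsD[OF distr_T_borel_probs[OF \<beta> F_carrier]]
  have em: "emeasure (avg_measure T (F k) \<beta>) A = ennreal (\<Sum>g\<in>F k. 1 / card (F k) * measure (distr \<beta> borel (T g)) A)"
    if "A \<in> sets borel" for A
  proof -
    have "(\<Sum>g\<in>F k. emeasure (distr \<beta> borel (T g)) A) = ennreal (\<Sum>g\<in>F k. measure (distr \<beta> borel (T g)) A)"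
    proof -
      have "emeasure (distr \<beta> borel (T g)) A = ennreal (measure (distr \<beta> borel (T g)) A)" if "g \<in> F k" for g
        using N(1)[OF that] by (simp add: finite_measure.emeasure_eq_measure prob_space_def)
      then show ?thesis by (simp add: sum_ennreal cong: sum.cong)
    qed
    then show ?thesis
      using emeasure_avg_measure[OF \<beta> that, of k] card_F_pos[of k]
      by (simp add: ennreal_of_nat_eq_real_of_nat divide_ennreal sum_nonneg sum_divide_distrib)
  qed
  have "measure (distr \<beta> borel (T g)) UNIV = 1" if "g \<in> F k" for g
    using prob_space.prob_space[OF N(1)[OF that]] by simp
  then have "emeasure (avg_measure T (F k) \<beta>) UNIV = 1" using em[of UNIV] card_F_pos[of k] by simp
  then show "avg_measure T (F k) \<beta> \<in> borel_probs"
    using s by (auto simp: borel_probs_def intro!: prob_spaceI)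
  show "A \<in> sets borel \<Longrightarrow> measure (avg_measure T (F k) \<beta>) A = (\<Sum>g\<in>F k. 1 / card (F k) * measure (distr \<beta> borel (T g)) A)"
    using em[of A] by (simp add: measure_def[of "avg_measure T (F k) \<beta>"] sum_nonneg)
qed

text \<open>Averaging measures is dual to averaging functions: the averaged measure mixes the
  pushforwards with equal weights.\<close>

lemma integral_avg_measure:
  fixes f :: "'x \<Rightarrow> real"
  assumes \<beta>: "\<beta> \<in> borel_probs" and f: "continuous_on UNIV f"
  shows "(\<integral>x. f x \<partial>avg_measure T (F k) \<beta>) = (\<integral>x. avg k f x \<partial>\<beta>)"
proof -
  obtain B where B: "\<And>x. \<bar>f x\<bar> \<le> B" using continuous_on_UNIV_abs_bounded[OF compact_space f] by blast
  have fb: "f \<in> borel_measurable borel" using borel_measurable_continuous_onI[OF f] .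
  interpret prob_space \<beta> by (rule borel_probsD[OF \<beta>])
  have "(\<integral>x. f x \<partial>avg_measure T (F k) \<beta>) = (\<Sum>g\<in>F k. 1 / card (F k) * (\<integral>x. f x \<partial>distr \<beta> borel (T g)))"
    using F(1) avg_measure_borel_probs[OF \<beta>] distr_T_borel_probs[OF \<beta> F_carrier] fb B
    by (intro integral_mixture[where B = B]) auto
  also have "\<dots> = (\<Sum>g\<in>F k. 1 / card (F k) * (\<integral>x. f (T g x) \<partial>\<beta>))"
    using measurable_T[OF F_carrier] borel_probsD(2)[OF \<beta>] fb
    by (intro sum.cong) (auto simp: integral_distr cong: measurable_cong_sets)
  also have "\<dots> = (\<integral>x. avg k f x \<partial>\<beta>)"
  proof -
    have "integrable \<beta> (\<lambda>x. f (T g x))" if "g \<in> F k" for g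
      using compact_space continuous_comp_T[OF f F_carrier[OF that]] finite_measure_axioms borel_probsD(2)[OF \<beta>]
      by (rule integrable_continuous)
    then show ?thesis unfolding avg_def by (simp add: sum_divide_distrib)
  qed
  finally show ?thesis .
qed

end

section \<open>Radii for a single averaging set\<close>

lemma finite_separation:
  fixes P :: "'a::metric_space set"
  assumes "finite P"
  obtains R where "R > 0" "\<And>p q. p \<in> P \<Longrightarrow> q \<in> P \<Longrightarrow> p \<noteq> q \<Longrightarrow> 2 * R \<le> dist p q"
proof -
  define D where "D = (\<lambda>(p, q). dist p q) ` {z \<in> P \<times> P. fst z \<noteq> snd z}"
  have D: "finite D" unfolding D_def using assms by auto
  \<comment> \<open>The inserted 1 keeps the minimum meaningful when there are no two distinct
    points.\<close>
  define R where "R = Min (insert 1 D) / 2"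
  have "R > 0" unfolding R_def using D by (auto simp: D_def)
  moreover have "2 * R \<le> dist p q" if "p \<in> P" "q \<in> P" "p \<noteq> q" for p q
  proof -
    have "dist p q \<in> D" unfolding D_def using that by force
    then show ?thesis unfolding R_def using D by simp
  qed
  ultimately show ?thesis using that by blast
qed

text \<open>The set \<open>A\<close> is carried along so that conditioning on the union splits into
  conditioning on the single balls.\<close>

lemma measure_union_balls:
  fixes \<mu> :: "'a::metric_space measure"
  assumes \<mu>: "\<mu> \<in> borel_probs" and P: "finite P"
    and disj: "\<And>p q. p \<in> P \<Longrightarrow> q \<in> P \<Longrightarrow> p \<noteq> q \<Longrightarrow> \<rho> p + \<rho> q \<le> dist p q" and A: "A \<in> sets borel"
  shows "measure \<mu> ((\<Union>p\<in>P. ball p (\<rho> p)) \<inter> A) = (\<Sum>p\<in>P. measure \<mu> (ball p (\<rho> p) \<inter> A))"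
proof -
  interpret prob_space \<mu> by (rule borel_probsD[OF \<mu>])
  have "disjnt (ball p (\<rho> p)) (ball q (\<rho> q))" if "p \<in> P" "q \<in> P" "p \<noteq> q" for p q
  proof (rule ccontr)
    assume "\<not> disjnt (ball p (\<rho> p)) (ball q (\<rho> q))"
    then obtain z where "dist p z < \<rho> p" "dist q z < \<rho> q" by (auto simp: disjnt_iff)
    then show False using disj[OF that] dist_triangle2[of p q z] by simp
  qed
  then have "pairwise (\<lambda>p q. disjnt (ball p (\<rho> p) \<inter> A) (ball q (\<rho> q) \<inter> A)) P"
    by (auto simp: pairwise_def disjnt_iff)
  then show ?thesis
    using P A borel_probsD(2)[OF \<mu>] unfolding Int_commute[of _ A] Int_UN_distrib
    by (intro measure_UNION') (auto simp: fmeasurable_eq_sets)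
qed

context tempered_action
begin

lemma small_radius:
  assumes "finite P" "R0 > 0" "\<eta> > 0"
  obtains R where "R > 0" "R \<le> R0"
    "\<And>p y g. p \<in> P \<Longrightarrow> dist p y < R \<Longrightarrow> g \<in> F k \<Longrightarrow> dist (T g y) (T g p) < \<eta>"
proof -
  have "\<exists>d>0. \<forall>y. dist p y < d \<longrightarrow> (\<forall>g\<in>F k. dist (T g y) (T g p) < \<eta>)" for p
  proof -
    have "\<forall>\<^sub>F y in nhds p. dist (T g y) (T g p) < \<eta>" if "g \<in> F k" for g
    proof -
      have "isCont (T g) p"
        using continuous_T[OF F_carrier[OF that]] by (simp add: continuous_on_eq_continuous_at)
      then have "(T g \<longlongrightarrow> T g p) (nhds p)" by (simp add: isCont_def tendsto_at_iff_tendsto_nhds)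
      then show ?thesis using assms(3) by (rule tendstoD)
    qed
    then have "\<forall>\<^sub>F y in nhds p. \<forall>g\<in>F k. dist (T g y) (T g p) < \<eta>"
      using F(1) by (simp add: eventually_ball_finite)
    then show ?thesis by (simp add: eventually_nhds_metric dist_commute)
  qed
  then obtain d where d: "d p > 0" "\<And>y g. dist p y < d p \<Longrightarrow> g \<in> F k \<Longrightarrow> dist (T g y) (T g p) < \<eta>" for p
    by metis
  have "Min (insert R0 (d ` P)) > 0" using assms d(1) by simp
  moreover have "dist (T g y) (T g p) < \<eta>"
    if "p \<in> P" "dist p y < Min (insert R0 (d ` P))" "g \<in> F k" for p y g
    using that assms(1) by (intro d(2)) auto
  ultimately show ?thesis using that[of "Min (insert R0 (d ` P))"] assms(1) by simp
qed

text \<open>The radii are fixed before \<open>f\<close>, so one choice serves all continuous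
  functions: it is enough that every \<open>T g\<close> with \<open>g \<in> F k\<close> sends each
  ball into the \<eta>-neighbourhood of the image of its centre. In the error, \<open>e\<close> is
  the oscillation of \<open>f\<close> at that scale, and \<open>card P * \<eta> * B\<close> is the
  price of perturbing the weights.\<close>

lemma single_scale:
  fixes u :: "'x \<Rightarrow> real" and \<eta> :: real
  assumes \<mu>: "\<mu> \<in> borel_probs" "neglects_shells \<mu>" and P: "finite P" "P \<noteq> {}"
    and pos: "\<And>p r. p \<in> P \<Longrightarrow> r > 0 \<Longrightarrow> 0 < measure \<mu> (ball p r)"
    and u: "\<And>p. p \<in> P \<Longrightarrow> 0 \<le> u p" "sum u P = 1" and \<eta>: "0 < \<eta>" "\<eta> \<le> 1"
  obtains \<rho> where "\<And>p. p \<in> P \<Longrightarrow> 0 < \<rho> p" "0 < measure \<mu> (\<Union>p\<in>P. ball p (\<rho> p))"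
    "\<And>f B e. continuous_on UNIV f \<Longrightarrow> (\<And>x. \<bar>f x\<bar> \<le> B) \<Longrightarrow> (\<And>y z. dist y z < \<eta> \<Longrightarrow> \<bar>f y - f z\<bar> \<le> e) \<Longrightarrow>
       \<bar>(\<integral>x. f x \<partial>avg_measure T (F k) (uniform_measure \<mu> (\<Union>p\<in>P. ball p (\<rho> p)))) - (\<Sum>p\<in>P. u p * avg k f p)\<bar>
         \<le> e + card P * \<eta> * B"
proof -
  \<comment> \<open>A ball of positive radius around a point of \<open>P\<close> has positive
    measure, while \<open>u p\<close> may be 0. Mixing in the uniform weight keeps the total at 1
    and moves each weight by at most \<eta>.\<close>
  define W where "W p = (1 - \<eta>) * u p + \<eta> / card P" for p
  have card: "card P > 0" using P by (simp add: card_gt_0_iff)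
  have W_pos: "0 < W p" if "p \<in> P" for p
    using u(1)[OF that] \<eta> card by (auto simp: W_def intro!: add_nonneg_pos)
  have W_sum: "sum W P = 1"
    using u(2) card by (simp add: W_def sum.distrib sum_distrib_left[symmetric])
  have u_le: "u p \<le> 1" if "p \<in> P" for p
    using member_le_sum[of p P u] P u that by simp
  have W_near: "\<bar>W p - u p\<bar> \<le> \<eta>" if "p \<in> P" for p
  proof -
    have "W p - u p = \<eta> * (1 / card P - u p)" by (simp add: W_def algebra_simps)
    moreover have "0 \<le> 1 / real (card P)" "1 / real (card P) \<le> 1" using card by auto
    then have "\<bar>1 / card P - u p\<bar> \<le> 1" using u(1)[OF that] u_le[OF that] unfolding abs_le_iff by linarith
    ultimately show ?thesis using \<eta> by (simp add: abs_mult mult_left_le)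
  qed
  obtain R0 where R0: "R0 > 0" "\<And>p q. p \<in> P \<Longrightarrow> q \<in> P \<Longrightarrow> p \<noteq> q \<Longrightarrow> 2 * R0 \<le> dist p q"
    using finite_separation[OF P(1)] by blast
  obtain R where R: "R > 0" "R \<le> R0"
    "\<And>p y g. p \<in> P \<Longrightarrow> dist p y < R \<Longrightarrow> g \<in> F k \<Longrightarrow> dist (T g y) (T g p) < \<eta>"
    using small_radius[OF P(1) R0(1) \<eta>(1), of k] by blast
  obtain m \<rho> where m: "m > 0" and \<rho>: "\<And>p. p \<in> P \<Longrightarrow> 0 < \<rho> p" "\<And>p. p \<in> P \<Longrightarrow> \<rho> p \<le> R"
    "\<And>p. p \<in> P \<Longrightarrow> measure \<mu> (ball p (\<rho> p)) = m * W p"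
    using proportional_balls[of \<mu> P R W, OF \<mu> P pos R(1) W_pos] by blast
  let ?U = "\<Union>p\<in>P. ball p (\<rho> p)"
  let ?\<alpha> = "uniform_measure \<mu> ?U"
  have "\<rho> p + \<rho> q \<le> dist p q" if "p \<in> P" "q \<in> P" "p \<noteq> q" for p q
    using R0(2)[OF that] \<rho>(2)[OF that(1)] \<rho>(2)[OF that(2)] R(2) by linarith
  then have split: "measure \<mu> (?U \<inter> A) = (\<Sum>p\<in>P. measure \<mu> (ball p (\<rho> p) \<inter> A))" if "A \<in> sets borel" for A
    using that by (intro measure_union_balls \<mu> P)
  have U_meas: "measure \<mu> ?U = m"
    using split[of UNIV] \<rho>(3) W_sum by (simp add: sum_distrib_left[symmetric])
  have U: "?U \<in> sets borel" by (intro borel_open open_UN) auto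
  have \<alpha>: "?\<alpha> \<in> borel_probs" using \<mu>(1) U m U_meas by (intro uniform_measure_borel_probs) auto
  have ball_pos: "0 < measure \<mu> (ball p (\<rho> p))" if "p \<in> P" for p
    using pos[OF that \<rho>(1)[OF that]] .
  have ball_probs: "uniform_measure \<mu> (ball p (\<rho> p)) \<in> borel_probs" if "p \<in> P" for p
    using \<mu>(1) ball_pos[OF that] by (intro uniform_measure_borel_probs) auto
  show ?thesis
  proof (rule that)
    show "0 < \<rho> p" if "p \<in> P" for p using \<rho>(1) that .
    show "0 < measure \<mu> ?U" using U_meas m by simp
    fix f :: "'x \<Rightarrow> real" and B e
    assume f: "continuous_on UNIV f" and B: "\<And>x. \<bar>f x\<bar> \<le> B"
      and e: "\<And>y z. dist y z < \<eta> \<Longrightarrow> \<bar>f y - f z\<bar> \<le> e"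
    have avg_B: "\<bar>avg k f x\<bar> \<le> B" for x
      using abs_avg_le[of k f x] avg_mono[of "\<lambda>x. \<bar>f x\<bar>" "\<lambda>_. B" k x] B by (simp add: avg_const)
    have avg_meas: "avg k f \<in> borel_measurable borel"
      using borel_measurable_continuous_onI[OF continuous_avg[OF f]] .
    have near: "\<bar>(\<integral>x. avg k f x \<partial>uniform_measure \<mu> (ball p (\<rho> p))) - avg k f p\<bar> \<le> e" if p: "p \<in> P" for p
    proof (rule integral_uniform_measure_near[OF \<mu>(1) _ ball_pos[OF p] avg_meas avg_B])
      fix y assume "y \<in> ball p (\<rho> p)"
      then have "dist p y < R" using \<rho>(2)[OF p] by simp
      then have le: "\<bar>f (T g y) - f (T g p)\<bar> \<le> e" if "g \<in> F k" for g
        using R(3)[OF p _ that] e by blast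
      have "\<bar>(\<Sum>g\<in>F k. f (T g y)) - (\<Sum>g\<in>F k. f (T g p))\<bar> \<le> (\<Sum>g\<in>F k. \<bar>f (T g y) - f (T g p)\<bar>)"
        unfolding sum_subtractf[symmetric] by (rule sum_abs)
      also have "\<dots> \<le> card (F k) * e" using sum_bounded_above[of "F k" _ e] le by simp
      finally show "\<bar>avg k f y - avg k f p\<bar> \<le> e"
        using card_F_pos[of k] by (simp add: avg_def diff_divide_distrib[symmetric] pos_divide_le_eq mult.commute)
    qed simp
    have "(\<integral>x. f x \<partial>avg_measure T (F k) ?\<alpha>) = (\<integral>x. avg k f x \<partial>?\<alpha>)"
      using integral_avg_measure[OF \<alpha> f] .
    \<comment> \<open>The balls are disjoint, have measures \<open>m * W p\<close> and total measure
      \<open>m\<close>; hence the weights of the mixture are exactly \<open>W p\<close>.\<close>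
    also have "\<dots> = (\<Sum>p\<in>P. W p * (\<integral>x. avg k f x \<partial>uniform_measure \<mu> (ball p (\<rho> p))))"
    proof (rule integral_mixture[OF P(1) \<alpha> ball_probs _ avg_meas avg_B])
      fix A :: "'x set" assume A: "A \<in> sets borel"
      interpret prob_space \<mu> by (rule borel_probsD[OF \<mu>(1)])
      have "measure ?\<alpha> A = (\<Sum>p\<in>P. measure \<mu> (ball p (\<rho> p) \<inter> A)) / m"
        using U A m U_meas split[OF A] borel_probsD(2)[OF \<mu>(1)]
        by (subst measure_uniform_measure) (auto simp: emeasure_eq_measure)
      also have "\<dots> = (\<Sum>p\<in>P. W p * measure (uniform_measure \<mu> (ball p (\<rho> p))) A)"
        unfolding sum_divide_distrib
      proof (rule sum.cong[OF refl])
        fix p assume p: "p \<in> P"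
        have "measure (uniform_measure \<mu> (ball p (\<rho> p))) A = measure \<mu> (ball p (\<rho> p) \<inter> A) / (m * W p)"
          using A ball_pos[OF p] \<rho>(3)[OF p] borel_probsD(2)[OF \<mu>(1)]
          by (subst measure_uniform_measure) (auto simp: emeasure_eq_measure)
        then show "measure \<mu> (ball p (\<rho> p) \<inter> A) / m = W p * measure (uniform_measure \<mu> (ball p (\<rho> p))) A"
          using W_pos[OF p] m by simp
      qed
      finally show "measure ?\<alpha> A = (\<Sum>p\<in>P. W p * measure (uniform_measure \<mu> (ball p (\<rho> p))) A)" .
    qed
    \<comment> \<open>The error separates into the deviation inside each ball, weighted by
      \<open>W p\<close>, and the change of weight times the average at the centre.\<close>
    finally have "\<bar>(\<integral>x. f x \<partial>avg_measure T (F k) ?\<alpha>) - (\<Sum>p\<in>P. u p * avg k f p)\<bar>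
        = \<bar>\<Sum>p\<in>P. W p * ((\<integral>x. avg k f x \<partial>uniform_measure \<mu> (ball p (\<rho> p))) - avg k f p) + (W p - u p) * avg k f p\<bar>"
      by (simp add: sum_subtractf[symmetric] algebra_simps)
    also have "\<dots> \<le> (\<Sum>p\<in>P. W p * e + \<eta> * B)"
    proof (rule order_trans[OF sum_abs sum_mono])
      fix p assume p: "p \<in> P"
      have "\<bar>W p * ((\<integral>x. avg k f x \<partial>uniform_measure \<mu> (ball p (\<rho> p))) - avg k f p)\<bar> \<le> W p * e"
        using near[OF p] W_pos[OF p] by (simp add: abs_mult)
      moreover have "\<bar>(W p - u p) * avg k f p\<bar> \<le> \<eta> * B"
        unfolding abs_mult using W_near[OF p] avg_B[of p] \<eta> by (intro mult_mono) auto
      ultimately show "\<bar>W p * ((\<integral>x. avg k f x \<partial>uniform_measure \<mu> (ball p (\<rho> p))) - avg k f p) + (W p - u p) * avg k f p\<bar>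
          \<le> W p * e + \<eta> * B" by linarith
    qed
    also have "\<dots> = e + card P * \<eta> * B"
      using W_sum by (simp add: sum.distrib sum_distrib_right[symmetric])
    finally show "\<bar>(\<integral>x. f x \<partial>avg_measure T (F k) ?\<alpha>) - (\<Sum>p\<in>P. u p * avg k f p)\<bar> \<le> e + card P * \<eta> * B" .
  qed
qed

lemma asymptotic_radii:
  fixes x :: "'i \<Rightarrow> 'x" and w :: "nat \<Rightarrow> 'i \<Rightarrow> real"
  assumes \<mu>: "\<mu> \<in> borel_probs" "neglects_shells \<mu>" and I: "finite I" "I \<noteq> {}"
    and pos: "\<And>i r. i \<in> I \<Longrightarrow> r > 0 \<Longrightarrow> 0 < emeasure \<mu> (ball (x i) r)"
    and gen: "\<And>i. i \<in> I \<Longrightarrow> generic (\<theta> i) (x i)"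
    and w: "\<And>k i. i \<in> I \<Longrightarrow> 0 \<le> w k i" "\<And>k. sum (w k) I = 1"
  obtains r where "admissible_radii \<mu> I x r"
    "\<And>k. avg_measure T (F k) (uniform_measure \<mu> (union_ball I x (\<lambda>i. r i k))) \<in> borel_probs"
    "\<And>f. continuous_on UNIV f \<Longrightarrow>
      (\<lambda>k. (\<integral>y. f y \<partial>avg_measure T (F k) (uniform_measure \<mu> (union_ball I x (\<lambda>i. r i k))))
         - (\<Sum>i\<in>I. w k i * (\<integral>y. f y \<partial>\<theta> i))) \<longlonglongrightarrow> 0"
proof -
  interpret prob_space \<mu> by (rule borel_probsD[OF \<mu>(1)])
  \<comment> \<open>Distinct indices may share a point, and then their balls cannot be disjoint. The
    construction therefore runs over the set of points, and \<open>u\<close> adds the weights of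
    equal points.\<close>
  define P where "P = x ` I"
  have P: "finite P" "P \<noteq> {}" using I by (auto simp: P_def)
  have pos': "0 < measure \<mu> (ball p r)" if "p \<in> P" "r > 0" for p r
    using that pos by (auto simp: P_def emeasure_eq_measure)
  define u where "u k p = (\<Sum>i\<in>{i \<in> I. x i = p}. w k i)" for k p
  have regroup: "(\<Sum>p\<in>P. u k p * h p) = (\<Sum>i\<in>I. w k i * h (x i))" for k h
  proof -
    have "(\<Sum>i\<in>I. w k i * h (x i)) = (\<Sum>p\<in>P. \<Sum>i\<in>{i \<in> I. x i = p}. w k i * h (x i))"
      unfolding P_def using I(1) by (rule sum.image_gen)
    then show ?thesis by (simp add: u_def sum_distrib_right)
  qed
  have u: "0 \<le> u k p" "sum (u k) P = 1" for k p
    using w regroup[of k "\<lambda>_. 1"] by (auto simp: u_def intro: sum_nonneg)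
  \<comment> \<open>Taking \<eta> as \<open>1 / Suc k\<close> ties the fineness to the index, so
    that both error terms vanish along the sequence.\<close>
  define good where "good k \<rho> \<longleftrightarrow> (\<forall>p\<in>P. 0 < \<rho> p) \<and> 0 < measure \<mu> (\<Union>p\<in>P. ball p (\<rho> p)) \<and>
    (\<forall>f B e. continuous_on UNIV f \<longrightarrow> (\<forall>x. \<bar>f x\<bar> \<le> B) \<longrightarrow> (\<forall>y z. dist y z < 1 / real (Suc k) \<longrightarrow> \<bar>f y - f z\<bar> \<le> e) \<longrightarrow>
       \<bar>(\<integral>x. f x \<partial>avg_measure T (F k) (uniform_measure \<mu> (\<Union>p\<in>P. ball p (\<rho> p)))) - (\<Sum>p\<in>P. u k p * avg k f p)\<bar>
         \<le> e + card P * (1 / real (Suc k)) * B)" for k \<rho>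
  have "\<exists>\<rho>. good k \<rho>" for k
    unfolding good_def
    by (rule single_scale[where u = "u k" and \<eta> = "1 / real (Suc k)" and k = k, OF \<mu> P pos' u])
      (assumption, assumption, simp, simp, blast)
  then obtain \<rho> where good: "good k (\<rho> k)" for k by metis
  have \<rho>: "\<And>k p. p \<in> P \<Longrightarrow> 0 < \<rho> k p" "\<And>k. 0 < measure \<mu> (\<Union>p\<in>P. ball p (\<rho> k p))"
    "\<And>k f B e. continuous_on UNIV f \<Longrightarrow> (\<forall>x. \<bar>f x\<bar> \<le> B) \<Longrightarrow> (\<forall>y z. dist y z < 1 / real (Suc k) \<longrightarrow> \<bar>f y - f z\<bar> \<le> e) \<Longrightarrow>
       \<bar>(\<integral>x. f x \<partial>avg_measure T (F k) (uniform_measure \<mu> (\<Union>p\<in>P. ball p (\<rho> k p)))) - (\<Sum>p\<in>P. u k p * avg k f p)\<bar>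
         \<le> e + card P * (1 / real (Suc k)) * B"
    using good unfolding good_def by blast+
  \<comment> \<open>Indices with the same point receive the same radius, so the union over
    \<open>I\<close> is the union over \<open>P\<close>.\<close>
  define r where "r i k = \<rho> k (x i)" for i k
  have U: "union_ball I x (\<lambda>i. r i k) = (\<Union>p\<in>P. ball p (\<rho> k p))" for k
    by (simp add: union_ball_def P_def r_def)
  show ?thesis
  proof (rule that[of r])
    show "admissible_radii \<mu> I x r"
      using \<rho>(1,2) unfolding admissible_radii_def U by (auto simp: r_def P_def emeasure_eq_measure)
    show "avg_measure T (F k) (uniform_measure \<mu> (union_ball I x (\<lambda>i. r i k))) \<in> borel_probs" for k
      unfolding U by (intro avg_measure_borel_probs uniform_measure_borel_probs \<mu> \<rho> borel_open open_UN) auto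
    fix f :: "'x \<Rightarrow> real" assume f: "continuous_on UNIV f"
    obtain B where B: "\<And>x. \<bar>f x\<bar> \<le> B" using continuous_on_UNIV_abs_bounded[OF compact_space f] by blast
    let ?\<nu> = "\<lambda>k. \<integral>y. f y \<partial>avg_measure T (F k) (uniform_measure \<mu> (union_ball I x (\<lambda>i. r i k)))"
    let ?\<tau> = "\<lambda>k. \<Sum>i\<in>I. w k i * (\<integral>y. f y \<partial>\<theta> i)"
    \<comment> \<open>The first term comes from the perturbed weights, the second from genericity at
      the centres; the oscillation of \<open>f\<close> inside the balls is estimated apart by e /
      2.\<close>
    let ?s = "\<lambda>k. card P * (1 / real (Suc k)) * B + (\<Sum>i\<in>I. \<bar>avg k f (x i) - (\<integral>y. f y \<partial>\<theta> i)\<bar>)"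
    have "(\<lambda>k. 1 / real (Suc k)) \<longlonglongrightarrow> 0" by (rule LIMSEQ_Suc) (rule lim_const_over_n)
    moreover have "(\<lambda>k. \<Sum>i\<in>I. \<bar>avg k f (x i) - (\<integral>y. f y \<partial>\<theta> i)\<bar>) \<longlonglongrightarrow> (\<Sum>i\<in>I. 0)"
      using gen f by (intro tendsto_sum tendsto_rabs_zero) (simp add: generic_def LIM_zero_iff)
    ultimately have "?s \<longlonglongrightarrow> real (card P) * 0 * B + (\<Sum>i\<in>I. 0)"
      by (intro tendsto_add tendsto_mult_right tendsto_mult_left)
    then have s: "?s \<longlonglongrightarrow> 0" by simp
    show "(\<lambda>k. ?\<nu> k - ?\<tau> k) \<longlonglongrightarrow> 0"
    proof (rule tendstoI)
      fix e :: real assume e: "e > 0"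
      have "uniformly_continuous_on UNIV f" using compact_uniformly_continuous[OF f compact_space] .
      then obtain d where d: "d > 0" "\<And>y z. dist y z < d \<Longrightarrow> dist (f y) (f z) < e / 2"
        using e unfolding uniformly_continuous_on_def by (metis UNIV_I half_gt_zero)
      have "\<forall>\<^sub>F k in sequentially. 1 / real (Suc k) < d"
        using \<open>(\<lambda>k. 1 / real (Suc k)) \<longlonglongrightarrow> 0\<close> d(1) by (rule order_tendstoD)
      moreover have "\<forall>\<^sub>F k in sequentially. ?s k < e / 2" using s e by (intro order_tendstoD) auto
      ultimately show "\<forall>\<^sub>F k in sequentially. dist (?\<nu> k - ?\<tau> k) 0 < e"
      proof eventually_elim
        case (elim k)
        have "\<bar>f y - f z\<bar> \<le> e / 2" if "dist y z < 1 / real (Suc k)" for y z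
          using d(2)[of y z] that elim(1) by (simp add: dist_real_def)
        then have "\<bar>?\<nu> k - (\<Sum>i\<in>I. w k i * avg k f (x i))\<bar> \<le> e / 2 + card P * (1 / real (Suc k)) * B"
          using \<rho>(3)[OF f, of B k "e / 2"] B unfolding U regroup by blast
        moreover have "\<bar>(\<Sum>i\<in>I. w k i * avg k f (x i)) - ?\<tau> k\<bar> \<le> (\<Sum>i\<in>I. \<bar>avg k f (x i) - (\<integral>y. f y \<partial>\<theta> i)\<bar>)"
        proof -
          have "(\<Sum>i\<in>I. w k i * avg k f (x i)) - ?\<tau> k = (\<Sum>i\<in>I. w k i * (avg k f (x i) - (\<integral>y. f y \<partial>\<theta> i)))"
            by (simp add: sum_subtractf right_diff_distrib)
          also have "\<bar>\<dots>\<bar> \<le> (\<Sum>i\<in>I. \<bar>avg k f (x i) - (\<integral>y. f y \<partial>\<theta> i)\<bar>)"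
          proof (rule order_trans[OF sum_abs sum_mono])
            fix i assume i: "i \<in> I"
            have "w k i \<le> 1" using member_le_sum[of i I "w k"] I(1) i w by simp
            then show "\<bar>w k i * (avg k f (x i) - (\<integral>y. f y \<partial>\<theta> i))\<bar> \<le> \<bar>avg k f (x i) - (\<integral>y. f y \<partial>\<theta> i)\<bar>"
              using w(1)[OF i] by (simp add: abs_mult mult_left_le_one_le)
          qed
          finally show ?thesis .
        qed
        ultimately show ?case using elim(2) unfolding dist_real_def by linarith
      qed
    qed
  qed
qed

end

section \<open>Limit sets\<close>

text \<open>Along any subsequence the two sequences of integrals have the same limits. This replaces
  the averaged measures by explicit mixtures of the ergodic ones.\<close>

lemma LS_weak_star_cong:
  fixes z z' :: "nat \<Rightarrow> 'a::topological_space measure"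
  assumes z: "\<And>k. z k \<in> borel_probs" "\<And>k. z' k \<in> borel_probs"
    and diff: "\<And>f :: 'a \<Rightarrow> real. continuous_on UNIV f \<Longrightarrow> (\<lambda>k. (\<integral>x. f x \<partial>z k) - (\<integral>x. f x \<partial>z' k)) \<longlonglongrightarrow> 0"
  shows "LS weak_star z = LS weak_star z'"
proof -
  have "limitin weak_star (z \<circ> s) l sequentially \<longleftrightarrow> limitin weak_star (z' \<circ> s) l sequentially"
    if "strict_mono s" for s l
  proof -
    have "(\<lambda>k. \<integral>x. f x \<partial>z (s k)) \<longlonglongrightarrow> (\<integral>x. f x \<partial>l) \<longleftrightarrow> (\<lambda>k. \<integral>x. f x \<partial>z' (s k)) \<longlonglongrightarrow> (\<integral>x. f x \<partial>l)"
      if "continuous_on UNIV f" for f :: "'a \<Rightarrow> real"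
      using LIMSEQ_subseq_LIMSEQ[OF diff[OF that] \<open>strict_mono s\<close>]
      by (intro Lim_transform_eq) (simp add: o_def)
    then show ?thesis using z by (simp add: limitin_weak_star)
  qed
  then show ?thesis unfolding LS_def by blast
qed

text \<open>The hull is formed over a set, in which a repeated \<open>\<theta> i\<close> counts
  once. Its weight goes to one representative index chosen by \<open>inv_into\<close>, and all other
  indices get 0.\<close>

lemma measure_hull_weights:
  assumes M: "M \<in> measure_hull (\<theta> ` I)" and I: "finite I"
  obtains w :: "'i \<Rightarrow> real" where "\<And>i. i \<in> I \<Longrightarrow> 0 \<le> w i" "sum w I = 1"
    "\<And>A. A \<in> sets borel \<Longrightarrow> measure M A = (\<Sum>i\<in>I. w i * measure (\<theta> i) A)"
proof -
  obtain K v where K: "finite K" "K \<subseteq> \<theta> ` I" "\<forall>N\<in>K. 0 \<le> v N" "sum v K = (1 :: real)"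
    "\<forall>A\<in>sets borel. measure M A = (\<Sum>N\<in>K. v N * measure N A)"
    using M by (auto simp: measure_hull_def)
  define S where "S = inv_into I \<theta> ` K"
  define w where "w i = (if i \<in> S then v (\<theta> i) else 0)" for i
  have \<theta>_inv: "\<theta> (inv_into I \<theta> N) = N" "inv_into I \<theta> N \<in> I" if "N \<in> K" for N
    using that K(2) by (auto simp: f_inv_into_f inv_into_into)
  have S: "S \<subseteq> I" using \<theta>_inv by (auto simp: S_def)
  have transfer: "(\<Sum>i\<in>I. w i * h (\<theta> i)) = (\<Sum>N\<in>K. v N * h N)" for h
  proof -
    have "(\<Sum>i\<in>I. w i * h (\<theta> i)) = (\<Sum>i\<in>S. v (\<theta> i) * h (\<theta> i))"
      using I S by (intro sum.mono_neutral_cong_right) (auto simp: w_def)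
    also have "\<dots> = (\<Sum>N\<in>K. v N * h N)"
      unfolding S_def using \<theta>_inv by (subst sum.reindex) (auto intro!: inj_on_inverseI[where g = \<theta>] sum.cong)
    finally show ?thesis .
  qed
  show ?thesis
  proof (rule that[of w])
    show "0 \<le> w i" for i using K(3) \<theta>_inv by (auto simp: w_def S_def)
    show "sum w I = 1" using transfer[of "\<lambda>_. 1"] K(4) by simp
    show "measure M A = (\<Sum>i\<in>I. w i * measure (\<theta> i) A)" if "A \<in> sets borel" for A
      using transfer[of "\<lambda>N. measure N A"] K(5) that by simp
  qed
qed

text \<open>Decoding k as a pair and keeping the first entry repeats each element of a countable
  dense set infinitely often. A sequence in the dense set that tends to x can then be met in order
  along increasing indices.\<close>

lemma recurrent_dense_sequence:
  fixes S :: "'a::{metric_space, second_countable_topology} set"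
  assumes "S \<noteq> {}"
  obtains d :: "nat \<Rightarrow> 'a" where "\<forall>k. d k \<in> S" "\<forall>x\<in>S. \<exists>s. strict_mono s \<and> (d \<circ> s) \<longlonglongrightarrow> x"
proof -
  obtain D where D: "countable D" "D \<subseteq> S" "S \<subseteq> closure D" using separable[of S] by blast
  then have "D \<noteq> {}" using assms by auto
  define d where "d k = from_nat_into D (fst (prod_decode k))" for k
  have "\<exists>s. strict_mono s \<and> (d \<circ> s) \<longlonglongrightarrow> x" if x: "x \<in> S" for x
  proof -
    obtain a where a: "\<And>n. a n \<in> D" "a \<longlonglongrightarrow> x"
      using x D(3) closure_sequential[of x D] by blast
    have "\<exists>s. (\<forall>n. d (s n) = a n) \<and> (\<forall>n. s n < s (Suc n))"
    proof -
      have "\<exists>k>m. d k = a n" for n m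
      proof -
        obtain j where "from_nat_into D j = a n"
          using from_nat_into_surj[OF D(1) a(1)] by blast
        \<comment> \<open>The second entry leaves the value unchanged and pushes the index beyond
          \<open>m\<close>.\<close>
        then have "d (prod_encode (j, Suc m)) = a n" by (simp add: d_def)
        moreover have "m < prod_encode (j, Suc m)" using le_prod_encode_2[of "Suc m" j] by simp
        ultimately show ?thesis by blast
      qed
      then have "\<exists>s. \<forall>n. d (s n) = a n \<and> s n < s (Suc n)"
        by (intro dependent_nat_choice) blast+
      then show ?thesis by blast
    qed
    then obtain s where "\<And>n. d (s n) = a n" "strict_mono s" by (auto simp: strict_mono_Suc_iff)
    then show ?thesis using a(2) by (intro exI[of _ s]) (simp add: o_def)
  qed
  moreover have "d k \<in> S" for k
    using from_nat_into[OF \<open>D \<noteq> {}\<close>] D(2) by (auto simp: d_def)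
  ultimately show ?thesis using that by blast
qed

text \<open>Density is arranged among weight vectors: \<open>nat \<Rightarrow> real\<close> is a
  separable metric space with pointwise convergence, and coordinatewise convergence of weights gives
  weak* convergence of the mixtures. The measures \<open>M k\<close> are themselves members of \<C>,
  so closedness of \<C> excludes further limits.\<close>

lemma LS_weights_sequence:
  fixes \<theta> :: "nat \<Rightarrow> 'a::metric_space measure"
  assumes comp: "compact (UNIV :: 'a set)" and I: "finite I" and \<theta>: "\<And>i. i \<in> I \<Longrightarrow> \<theta> i \<in> borel_probs"
    and C: "\<C> \<subseteq> measure_hull (\<theta> ` I)" "compactin weak_star \<C>" "\<C> \<noteq> {}"
  obtains w :: "nat \<Rightarrow> nat \<Rightarrow> real" and M where "\<And>k i. i \<in> I \<Longrightarrow> 0 \<le> w k i" "\<And>k. sum (w k) I = 1" "\<And>k. M k \<in> borel_probs"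
    "\<And>k (f :: 'a \<Rightarrow> real). continuous_on UNIV f \<Longrightarrow> (\<integral>x. f x \<partial>M k) = (\<Sum>i\<in>I. w k i * (\<integral>x. f x \<partial>\<theta> i))"
    "LS weak_star M = \<C>"
proof -
  have C_probs: "N \<in> borel_probs" if "N \<in> \<C>" for N using that C(1) by (auto simp: measure_hull_def)
  have "\<exists>w :: nat \<Rightarrow> real. (\<forall>i\<in>I. 0 \<le> w i) \<and> sum w I = 1 \<and>
      (\<forall>A\<in>sets borel. measure N A = (\<Sum>i\<in>I. w i * measure (\<theta> i) A))" if "N \<in> \<C>" for N
    using measure_hull_weights[of N \<theta> I] that C(1) I by (metis subsetD)
  then obtain v :: "'a measure \<Rightarrow> nat \<Rightarrow> real" where v: "\<forall>i\<in>I. 0 \<le> v N i" "sum (v N) I = 1"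
    "\<forall>A\<in>sets borel. measure N A = (\<Sum>i\<in>I. v N i * measure (\<theta> i) A)" if "N \<in> \<C>" for N
    by metis
  have v_int: "(\<integral>x. f x \<partial>N) = (\<Sum>i\<in>I. v N i * (\<integral>x. f x \<partial>\<theta> i))" if N: "N \<in> \<C>" and f: "continuous_on UNIV f"
    for N and f :: "'a \<Rightarrow> real"
  proof -
    obtain B where "\<And>x. \<bar>f x\<bar> \<le> B" using continuous_on_UNIV_abs_bounded[OF comp f] by blast
    then show ?thesis
      using v(3)[OF N] I C_probs[OF N] \<theta> borel_measurable_continuous_onI[OF f]
      by (intro integral_mixture[where B = B]) auto
  qed
  have "v ` \<C> \<noteq> {}" using C(3) by simp
  then obtain d :: "nat \<Rightarrow> nat \<Rightarrow> real" where d: "\<forall>k. d k \<in> v ` \<C>" "\<forall>y\<in>v ` \<C>. \<exists>s. strict_mono s \<and> (d \<circ> s) \<longlonglongrightarrow> y"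
    by (rule recurrent_dense_sequence) (rule that)
  have "\<forall>k. \<exists>N. N \<in> \<C> \<and> d k = v N" using d(1) by blast
  then obtain M where M: "M k \<in> \<C>" "d k = v (M k)" for k by metis
  have M_probs: "M k \<in> borel_probs" for k using C_probs M(1) .
  have "LS weak_star M = \<C>"
  proof
    show "LS weak_star M \<subseteq> \<C>"
    proof
      fix l assume "l \<in> LS weak_star M"
      then obtain s where "limitin weak_star (M \<circ> s) l sequentially" by (auto simp: LS_def)
      moreover have "closedin weak_star \<C>"
        using compactin_imp_closedin[OF Hausdorff_space_weak_star C(2)] .
      ultimately show "l \<in> \<C>" by (rule limitin_closedin) (use M in auto)
    qed
    show "\<C> \<subseteq> LS weak_star M"
    proof
      fix N assume N: "N \<in> \<C>"
      then obtain s where s: "strict_mono s" "(d \<circ> s) \<longlonglongrightarrow> v N" using d(2) by blast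
      have coord: "(\<lambda>k. d (s k) i) \<longlonglongrightarrow> v N i" for i
      proof -
        have "isCont (\<lambda>y :: nat \<Rightarrow> real. y i) (v N)"
          by (rule continuous_on_interior[OF continuous_on_product_coordinates]) simp
        from isCont_tendsto_compose[OF this s(2)] show ?thesis by (simp add: o_def)
      qed
      have "limitin weak_star (M \<circ> s) N sequentially"
      proof (subst limitin_weak_star)
        show "N \<in> borel_probs \<and> (\<forall>f :: 'a \<Rightarrow> real. continuous_on UNIV f \<longrightarrow>
          (\<lambda>k. \<integral>x. f x \<partial>(M \<circ> s) k) \<longlonglongrightarrow> (\<integral>x. f x \<partial>N))"
        proof (intro conjI allI impI)
          fix f :: "'a \<Rightarrow> real" assume f: "continuous_on UNIV f"
          have "(\<lambda>k. \<Sum>i\<in>I. d (s k) i * (\<integral>x. f x \<partial>\<theta> i)) \<longlonglongrightarrow> (\<Sum>i\<in>I. v N i * (\<integral>x. f x \<partial>\<theta> i))"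
            by (intro tendsto_intros coord)
          then show "(\<lambda>k. \<integral>x. f x \<partial>(M \<circ> s) k) \<longlonglongrightarrow> (\<integral>x. f x \<partial>N)"
            by (simp add: v_int[OF M(1) f] v_int[OF N f] M(2))
        qed (rule C_probs[OF N])
      qed (use M_probs in simp)
      then show "N \<in> LS weak_star M" using s(1) by (auto simp: LS_def)
    qed
  qed
  then show ?thesis using that[of "\<lambda>k. v (M k)" M] v M(1) M_probs v_int by blast
qed

theorem theorem5p2:
  fixes G :: "('g, 'b) monoid_scheme"
    and T :: "'g \<Rightarrow> 'a::metric_space \<Rightarrow> 'a"
    and F :: "nat \<Rightarrow> 'g set"
    and \<mu> :: "'a measure"
    and n :: nat
    and \<theta> :: "nat \<Rightarrow> 'a measure"
    and \<C> :: "'a measure set"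
  assumes "compact (UNIV :: 'a set)"
    and "group G" and "amenable G"
    and "holder_action G T"
    and "\<forall>i\<in>{1..n}. \<theta> i \<in> extreme_measures (invariant_measures G T)"
    and "\<C> \<subseteq> measure_hull (\<theta> ` {1..n})" and "compactin weak_star \<C>" and "\<C> \<noteq> {}"
    and "folner_seq G F" and "tempered G F"
    and "\<mu> \<in> borel_probs" and "neglects_shells \<mu>"
    and "\<forall>i\<in>{1..n}. AE x in \<theta> i. \<forall>r>0. 0 < emeasure \<mu> (ball x r)"
  shows "(\<exists>x r. admissible_radii \<mu> {1..n} x r \<and>
            LS weak_star (\<lambda>k. avg_measure T (F k)
              (uniform_measure \<mu> (union_ball {1..n} x (\<lambda>i. r i k)))) = \<C>) \<and>
         (AE x in PiM {1..n} \<theta>. \<exists>r. admissible_radii \<mu> {1..n} x r \<and>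
            LS weak_star (\<lambda>k. avg_measure T (F k)
              (uniform_measure \<mu> (union_ball {1..n} x (\<lambda>i. r i k)))) = \<C>)"
proof -
  interpret group G by fact
  interpret group_action G UNIV T using assms(4) by (simp add: holder_action_def)
  obtain c where c: "c > 0"
    "\<And>k. k \<ge> 1 \<Longrightarrow> real (card (\<Union>j<k. set_inv\<^bsub>G\<^esub> (F j) <#>\<^bsub>G\<^esub> F k)) \<le> c * real (card (F k))"
    using assms(10) by (auto simp: tempered_def)
  \<comment> \<open>For \<open>k = 0\<close> the union is empty, so the bound extends to all
    indices.\<close>
  have temp: "real (card (\<Union>j<k. set_inv\<^bsub>G\<^esub> (F j) <#>\<^bsub>G\<^esub> F k)) \<le> c * real (card (F k))" for k
    using c by (cases "k = 0") auto
  interpret tempered_action G F c T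
  proof
    show "finite (F k)" "F k \<noteq> {}" "F k \<subseteq> carrier G" for k
      using assms(9) by (auto simp: folner_seq_def)
    show "continuous_on UNIV (T g)" if "g \<in> carrier G" for g
      using assms(4) that by (auto simp: holder_action_def homeomorphism_def)
    show "(\<lambda>k. real (card (sym_diff (F k) (g <#\<^bsub>G\<^esub> F k))) / real (card (F k))) \<longlonglongrightarrow> 0"
      if "g \<in> carrier G" for g
      using assms(9) that by (simp add: folner_seq_def)
  qed (use c(1) temp assms(1) in auto)
  let ?I = "{1..n}"
  have \<theta>: "\<theta> i \<in> borel_probs" "prob_space (\<theta> i)" if "i \<in> ?I" for i
    using assms(5) that invariant_measuresD by (auto simp: extreme_measures_def)
  obtain w :: "nat \<Rightarrow> nat \<Rightarrow> real" and M where w: "\<And>k i. i \<in> ?I \<Longrightarrow> 0 \<le> w k i" "\<And>k. sum (w k) ?I = 1" and M: "\<And>k. M k \<in> borel_probs"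
    "\<And>k (f :: 'a \<Rightarrow> real). continuous_on UNIV f \<Longrightarrow> (\<integral>x. f x \<partial>M k) = (\<Sum>i\<in>?I. w k i * (\<integral>x. f x \<partial>\<theta> i))"
    and LS_M: "LS weak_star M = \<C>"
    using LS_weights_sequence[OF assms(1) _ \<theta>(1) assms(6-8)] by blast
  \<comment> \<open>Weights over an empty index set would have sum 0 instead of 1.\<close>
  have ne: "?I \<noteq> {}" by (rule notI) (use w(2)[of 0] in simp)
  \<comment> \<open>Genericity drives the convergence; positivity of the balls allows conditioning
    on them and prescribing their measures. Both concern one coordinate at a time, so the product
    measure only has to combine finitely many events of full probability.\<close>
  define good where "good i p \<longleftrightarrow> generic (\<theta> i) p \<and> (\<forall>r>0. 0 < emeasure \<mu> (ball p r))" for i p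
  have good: "AE p in \<theta> i. good i p" if "i \<in> ?I" for i
    unfolding good_def using AE_generic[of "\<theta> i"] assms(5,13) that by auto
  have main: "\<exists>r. admissible_radii \<mu> ?I x r \<and>
      LS weak_star (\<lambda>k. avg_measure T (F k) (uniform_measure \<mu> (union_ball ?I x (\<lambda>i. r i k)))) = \<C>"
    if x: "\<forall>i\<in>?I. good i (x i)" for x
  proof -
    have pos: "0 < emeasure \<mu> (ball (x i) r)" if "i \<in> ?I" "r > 0" for i r
      using x that by (simp add: good_def)
    have gen: "generic (\<theta> i) (x i)" if "i \<in> ?I" for i
      using x that by (simp add: good_def)
    obtain r where r: "admissible_radii \<mu> ?I x r"
      "\<And>k. avg_measure T (F k) (uniform_measure \<mu> (union_ball ?I x (\<lambda>i. r i k))) \<in> borel_probs"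
      "\<And>f. continuous_on UNIV f \<Longrightarrow>
        (\<lambda>k. (\<integral>y. f y \<partial>avg_measure T (F k) (uniform_measure \<mu> (union_ball ?I x (\<lambda>i. r i k))))
           - (\<Sum>i\<in>?I. w k i * (\<integral>y. f y \<partial>\<theta> i))) \<longlonglongrightarrow> 0"
      using asymptotic_radii[of \<mu> ?I x \<theta> w, OF assms(11,12) _ ne pos gen w] by blast
    have "LS weak_star (\<lambda>k. avg_measure T (F k) (uniform_measure \<mu> (union_ball ?I x (\<lambda>i. r i k)))) = LS weak_star M"
      using r(2,3) M by (intro LS_weak_star_cong) auto
    then show ?thesis using r(1) LS_M by blast
  qed
  \<comment> \<open>The tuple for the existence claim is picked coordinate by coordinate: what holds
    almost surely for a probability measure holds at some point.\<close>
  have "\<exists>p. good i p" if "i \<in> ?I" for i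
  proof -
    interpret prob_space "\<theta> i" by (rule \<theta>(2)[OF that])
    show ?thesis
    proof (rule ccontr)
      assume "\<nexists>p. good i p"
      then have "AE p in \<theta> i. False" using good[OF that] by simp
      then show False by simp
    qed
  qed
  then obtain x where "\<forall>i\<in>?I. good i (x i)" by metis
  moreover have "AE x in PiM ?I \<theta>. \<forall>i\<in>?I. good i (x i)"
    using \<theta>(2) good by (intro AE_ball_countable' AE_PiM_component) auto
  then have "AE x in PiM ?I \<theta>. \<exists>r. admissible_radii \<mu> ?I x r \<and>
      LS weak_star (\<lambda>k. avg_measure T (F k) (uniform_measure \<mu> (union_ball ?I x (\<lambda>i. r i k)))) = \<C>"
    by eventually_elim (rule main)
  ultimately show ?thesis using main by blast
qed

end
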